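(* Let $d_x,d_y\in\mathbb N$, let $\mathcal K\subset\mathbb R^{d_x}$ be compact, and let $\rho:\mathbb{R}\rightarrow\mathbb{R}$ be a continuous function that is not a polynomial and that is continuously differentiable at at least one point $z$, with $\rho'(z)\neq 0$. If $w\ge\max\{d_x+2,d_y+1\}$, then $\rho$ networks of width $w$ are dense in $L^p(\mathcal K,\mathbb{R}^{d_y})$ for all $p\in[1,\infty)$.
   Context: A $\rho$ network $f:\mathbb R^{d_x}\to\mathbb R^{d_y}$ with $L$ layers and hidden dimensions $d_1,\dots,d_{L-1}$ (set $d_0=d_x$, $d_L=d_y$) is $f=t_L\circ\sigma_{L-1}\circ\cdots\circ t_2\circ\sigma_1\circ t_1$, with each $t_\ell:\mathbb R^{d_{\ell-1}}\to\mathbb R^{d_\ell}$ affine and $\sigma_\ell$ applying $\rho$ coordinatewise. The width is $\max\{d_1,\dots,d_{L-1}\}$; depth is arbitrary. $L^p(\mathcal K,\mathbb R^{d_y})$ has norm $\|f\|_p=(\int_{\mathcal K}\|f(x)\|_p^p\,dx)^{1/p}$, and "dense" means: for every $f^*\in L^p(\mathcal K,\mathbb R^{d_y})$ and $\varepsilon>0$ there is such a network $f$ with $\|f^*-f\|_p\le\varepsilon$ (norm computed on $\mathcal K$). *)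

theory Defs
  imports "HOL-Analysis.Analysis" "HOL-Computational_Algebra.Polynomial"
begin

text \<open>Hidden layer vectors have varying dimension, so they are represented as
  functions nat => real, of which only the first d coordinates are ever read.
  Input space R^{d_x} is real^'n, output space R^{d_y} is real^'m.\<close>

definition affine_hidden :: "nat \<Rightarrow> (nat \<Rightarrow> nat \<Rightarrow> real) \<Rightarrow> (nat \<Rightarrow> real) \<Rightarrow> (nat \<Rightarrow> real) \<Rightarrow> (nat \<Rightarrow> real)" where
  "affine_hidden din A b h = (\<lambda>j. (\<Sum>i<din. A j i * h i) + b j)"

text \<open>Evaluation of a rho network with L = length dims + 1 layers and hidden
  dimensions dims = [d_1, ..., d_{L-1}]:
  first affine layer (A1, b1) : R^{d_x} -> R^{d_1},
  middle affine layers Ms (layer l maps R^{d_{l-1}} -> R^{d_l}),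
  last affine layer (AL, bL) : R^{d_{L-1}} -> R^{d_y};
  rho is applied coordinatewise after every affine layer but the last.\<close>
definition nn_eval ::
  "(real \<Rightarrow> real) \<Rightarrow> nat list \<Rightarrow> (nat \<Rightarrow> 'n::finite \<Rightarrow> real) \<Rightarrow> (nat \<Rightarrow> real)
   \<Rightarrow> ((nat \<Rightarrow> nat \<Rightarrow> real) \<times> (nat \<Rightarrow> real)) list
   \<Rightarrow> ('m::finite \<Rightarrow> nat \<Rightarrow> real) \<Rightarrow> real^'m \<Rightarrow> real^'n \<Rightarrow> real^'m" where
  "nn_eval \<rho> dims A1 b1 Ms AL bL x =
     (let h1 = (\<lambda>j. \<rho> ((\<Sum>i\<in>UNIV. A1 j i * x $ i) + b1 j));
          h = foldl (\<lambda>h (din, (A, b)). (\<lambda>j. \<rho> (affine_hidden din A b h j)))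
                    h1 (zip (butlast dims) Ms)
      in (\<chi> k. (\<Sum>i<last dims. AL k i * h i) + bL $ k))"

text \<open>A rho network of width w: at least two layers (so that the width
  max{d_1,...,d_{L-1}} is defined), correct number of middle layers, width = w.\<close>
definition is_rho_net_of_width ::
  "(real \<Rightarrow> real) \<Rightarrow> nat \<Rightarrow> (real^'n::finite \<Rightarrow> real^'m::finite) \<Rightarrow> bool" where
  "is_rho_net_of_width \<rho> w f \<longleftrightarrow>
     (\<exists>dims A1 b1 Ms AL bL. dims \<noteq> [] \<and> length Ms = length dims - 1 \<and>
        Max (set dims) = w \<and> f = nn_eval \<rho> dims A1 b1 Ms AL bL)"

definition Lp_pow :: "real \<Rightarrow> (real^'n::finite) set \<Rightarrow> (real^'n \<Rightarrow> real^'m::finite) \<Rightarrow> ennreal" where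
  "Lp_pow p K g = (\<integral>\<^sup>+ x\<in>K. ennreal (\<Sum>i\<in>UNIV. \<bar>g x $ i\<bar> powr p) \<partial>lebesgue)"

definition in_Lp :: "real \<Rightarrow> (real^'n::finite) set \<Rightarrow> (real^'n \<Rightarrow> real^'m::finite) \<Rightarrow> bool" where
  "in_Lp p K g \<longleftrightarrow> g \<in> borel_measurable (lebesgue_on K) \<and> Lp_pow p K g < \<infinity>"

end

theory Submission
  imports Defs
begin

text \<open>A network of width \<open>w\<close> can, up to an arbitrarily small uniform error on \<open>K\<close>, apply \<open>\<rho>\<close> to one
  coordinate of its state and keep the others, because difference quotients of \<open>\<rho>\<close> at a point with
  nonzero derivative approximate the identity. With one scratch coordinate it can therefore add to
  one coordinate any linear combination of functions \<open>\<rho> (l s + b)\<close>, where \<open>s\<close> is linear in the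
  remaining coordinates, and by the theorem of Leshno, Lin, Pinkus and Schocken any continuous
  function of \<open>s\<close>. Sums of exponentials of linear forms are dense by Stone-Weierstrass, so width
  \<open>d\<^sub>x + 2\<close> suffices for every continuous scalar function of the input, and width \<open>d\<^sub>y + 1\<close> turns a
  scalar \<open>t\<close> into any continuous graph \<open>(t, \<gamma>\<^sub>2 t, \<dots>, \<gamma>\<^sub>m t)\<close>. Finally the values of a simple function can
  be perturbed so that their first coordinates are distinct; they then lie on such a graph, and
  inner regularity with Tietze's extension theorem makes the first coordinate continuous
  off a set of small measure.\<close>

section \<open>Functions with vanishing differences\<close>

definition shift_diff :: "real \<Rightarrow> (real \<Rightarrow> real) \<Rightarrow> real \<Rightarrow> real" where
  "shift_diff h f = (\<lambda>x. f (x + h) - f x)"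

text \<open>For continuous \<open>f\<close> this singles out the polynomials of degree less than
  \<open>k\<close>. The step may change from one level to the next, so its failure supplies a usable
  step at every level, as in \<open>power_mem\<close>.\<close>

primrec differences_vanish :: "nat \<Rightarrow> (real \<Rightarrow> real) \<Rightarrow> bool" where
  "differences_vanish 0 f \<longleftrightarrow> f = (\<lambda>_. 0)"
| "differences_vanish (Suc k) f \<longleftrightarrow> (\<forall>h. differences_vanish k (shift_diff h f))"

lemma continuous_on_shift_diff:
  "continuous_on UNIV f \<Longrightarrow> continuous_on UNIV (shift_diff h f)"
  unfolding shift_diff_def
  by (rule continuous_on_diff[OF continuous_on_compose2[of UNIV f]]) (auto intro: continuous_intros)

text \<open>The difference of \<open>x ^ Suc k\<close> is \<open>(k + 1) * x ^ k\<close> plus lower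
  powers, by the binomial theorem; the induction hypothesis removes the lower powers.\<close>

lemma monom_antidifference:
  "\<exists>P. \<forall>x::real. poly P (x + 1) - poly P x = x ^ k"
proof (induction k rule: less_induct)
  case (less k)
  then obtain P where P: "\<And>j x::real. j < k \<Longrightarrow> poly (P j) (x + 1) - poly (P j) x = x ^ j"
    by metis
  define R where "R = smult (1 / (real k + 1)) (monom 1 (Suc k) - (\<Sum>j<k. smult (of_nat (Suc k choose j)) (P j)))"
  have "poly R (x + 1) - poly R x = x ^ k" for x
  proof -
    have "(x + 1) ^ Suc k = (\<Sum>j\<le>Suc k. of_nat (Suc k choose j) * x ^ j)"
      using binomial_ring[of x 1 "Suc k"] by simp
    also have "\<dots> = (\<Sum>j<k. of_nat (Suc k choose j) * x ^ j) + (real k + 1) * x ^ k + x ^ Suc k"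
      by (simp add: lessThan_Suc_atMost [symmetric])
    finally have "(x + 1) ^ Suc k - x ^ Suc k = (\<Sum>j<k. of_nat (Suc k choose j) * x ^ j) + (real k + 1) * x ^ k"
      by simp
    moreover have "(\<Sum>j<k. of_nat (Suc k choose j) * x ^ j) =
        (\<Sum>j<k. of_nat (Suc k choose j) * poly (P j) (x + 1)) - (\<Sum>j<k. of_nat (Suc k choose j) * poly (P j) x)"
      by (simp add: P sum_subtractf [symmetric] right_diff_distrib [symmetric])
    ultimately have "(real k + 1) * x ^ k = (x + 1) ^ Suc k - (\<Sum>j<k. of_nat (Suc k choose j) * poly (P j) (x + 1))
        - (x ^ Suc k - (\<Sum>j<k. of_nat (Suc k choose j) * poly (P j) x))"
      by linarith
    also have "\<dots> = (real k + 1) * (poly R (x + 1) - poly R x)"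
      by (simp add: R_def poly_sum poly_monom right_diff_distrib add_divide_distrib diff_divide_distrib del: power_Suc)
    finally show ?thesis by (simp del: of_nat_Suc)
  qed
  then show ?case by blast
qed

lemma poly_antidifference:
  "\<exists>P. \<forall>x::real. poly P (x + 1) - poly P x = poly Q x"
proof -
  obtain P where P: "\<And>k x::real. poly (P k) (x + 1) - poly (P k) x = x ^ k"
    using monom_antidifference by metis
  have "poly (\<Sum>i\<le>degree Q. smult (coeff Q i) (P i)) (x + 1)
      - poly (\<Sum>i\<le>degree Q. smult (coeff Q i) (P i)) x = poly Q x" for x
    by (simp add: poly_sum sum_subtractf [symmetric] right_diff_distrib [symmetric] P
        poly_altdef [of Q])
  then show ?thesis by blast
qed

lemma periodic_nat:
  fixes g :: "real \<Rightarrow> real"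
  assumes "\<And>x. g (x + 1) = g x"
  shows "g (x + real n) = g x"
proof (induction n)
  case (Suc n)
  then show ?case using assms[of "x + real n"] by (simp add: add_ac)
qed simp

text \<open>Subtracting the value at 0 leaves a polynomial that vanishes at every natural number,
  hence has infinitely many roots.\<close>

lemma periodic_poly_const:
  fixes q :: "real poly"
  assumes "\<And>x. poly q (x + 1) = poly q x"
  shows "poly q x = poly q 0"
proof -
  let ?r = "q - [:poly q 0:]"
  have "poly ?r (real n) = 0" for n
    using periodic_nat[of "poly q", OF assms, of 0 n] by simp
  then have "range real \<subseteq> {x. poly ?r x = 0}" by auto
  moreover have "infinite (range real)"
    by (simp add: finite_image_iff inj_on_def)
  ultimately have "?r = 0"
    using poly_roots_finite finite_subset by metis
  then show ?thesis
    by (metis eq_iff_diff_eq_0 poly_pCons poly_0 mult_zero_right add.right_neutral)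
qed

text \<open>Frechet's characterisation of polynomials. After subtracting an antidifference of
  \<^term>\<open>shift_diff 1 f\<close> the function is periodic, so its differences are periodic
  polynomials, hence constants; these vanish since the function is bounded.\<close>
lemma differences_vanish_imp_poly:
  assumes "continuous_on UNIV f" "differences_vanish k f"
  shows "\<exists>q. \<forall>x. f x = poly q x"
  using assms
proof (induction k arbitrary: f)
  case 0
  then show ?case by (auto intro!: exI[of _ 0])
next
  case (Suc k)
  then have "\<exists>q. \<forall>x. shift_diff h f x = poly q x" for h
    by (simp add: continuous_on_shift_diff)
  then obtain Q where Q: "\<And>h x. f (x + h) - f x = poly (Q h) x"
    unfolding shift_diff_def by metis
  obtain P where P: "\<And>x. poly P (x + 1) - poly P x = poly (Q 1) x"
    using poly_antidifference by metis
  define g where "g x = f x - poly P x" for x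
  have per: "g (x + 1) = g x" for x
    using Q[of x 1] P[of x] by (simp add: g_def)
  have contg: "continuous_on UNIV g"
    unfolding g_def by (intro continuous_intros Suc.prems)
  have "\<exists>c. \<forall>x. g (x + h) - g x = c" for h
  proof -
    \<comment> \<open>The difference of \<open>g\<close> with step \<open>h\<close>, written as a
      polynomial: \<open>pcompose P [:h, 1:]\<close> is \<open>P\<close> translated by
      \<open>h\<close>.\<close>
    define q where "q = Q h - (pcompose P [:h, 1:] - P)"
    have q: "poly q x = g (x + h) - g x" for x
      by (simp add: q_def g_def poly_pcompose Q [symmetric] add.commute)
    have "poly q (x + 1) = poly q x" for x
      using per[of "x + h"] per[of x] by (simp add: q add_ac)
    then show ?thesis using periodic_poly_const q by metis
  qed
  then obtain c where c: "\<And>h x. g (x + h) - g x = c h" by metis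
  obtain B where B: "\<And>x. x \<in> {0..1} \<Longrightarrow> \<bar>g x\<bar> \<le> B"
  proof -
    have "compact (g ` {0..1})"
      using contg by (intro compact_continuous_image) (auto elim: continuous_on_subset)
    then show ?thesis
      using that by (force dest!: compact_imp_bounded simp: bounded_iff)
  qed
  have bdd: "\<bar>g x\<bar> \<le> B" if "x \<ge> 0" for x
  proof -
    have "g x = g (frac x)"
      using periodic_nat[of g "frac x" "nat \<lfloor>x\<rfloor>", OF per] that by (simp add: frac_def)
    then show ?thesis using B[of "frac x"] by (simp add: frac_ge_0 less_imp_le[OF frac_lt_1])
  qed
  \<comment> \<open>From 0 to \<open>real n * h\<close> the function \<open>g\<close> changes by
    \<open>real n * c h\<close>, while its bound on the nonnegative half-line limits the change to
    \<open>2 * B\<close> for every \<open>n\<close>. Positive steps suffice, since a negative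
    \<open>x\<close> is joined to 0 by the step \<open>-x\<close>.\<close>
  have "c h = 0" if "h > 0" for h
  proof (rule ccontr)
    assume "c h \<noteq> 0"
    have mult: "g (real n * h) = g 0 + real n * c h" for n
    proof (induction n)
      case (Suc n)
      then show ?case using c[of "real n * h" h] by (simp add: algebra_simps)
    qed simp
    obtain n where n: "real n > (2 * B) / \<bar>c h\<bar>" using reals_Archimedean2 by blast
    have "\<bar>real n * c h\<bar> \<le> 2 * B"
      using mult[of n] bdd[of "real n * h"] bdd[of 0] that by auto
    then show False using n \<open>c h \<noteq> 0\<close> by (simp add: abs_mult field_simps)
  qed
  then have "g x = g 0" for x
    using c[of 0 x] c[of x "-x"] by (cases x "0 :: real" rule: linorder_cases) force+
  then have "f x = poly (P + [:g 0:]) x" for x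
    by (simp add: g_def algebra_simps)
  then show ?case by blast
qed

section \<open>Closed spaces containing a nonpolynomial function\<close>

text \<open>Uniform continuity on an interval enlarged by 1 at both ends, together with a radius of
  at most 1; thus only \<open>x\<close> has to be bounded, and \<open>y\<close> follows.\<close>

lemma continuous_modulus:
  fixes g :: "real \<Rightarrow> real"
  assumes "continuous_on UNIV g" "e > 0"
  obtains d where "d > 0" "\<And>x y. \<bar>x\<bar> \<le> M \<Longrightarrow> \<bar>y - x\<bar> < d \<Longrightarrow> \<bar>g y - g x\<bar> < e"
proof -
  have "uniformly_continuous_on {-M-1..M+1} g"
    using assms by (intro compact_uniformly_continuous) (auto elim: continuous_on_subset)
  then obtain d where d: "d > 0"
    "\<And>x y. x \<in> {-M-1..M+1} \<Longrightarrow> y \<in> {-M-1..M+1} \<Longrightarrow> dist y x < d \<Longrightarrow> dist (g y) (g x) < e"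
    unfolding uniformly_continuous_on_def using assms by metis
  show ?thesis
  proof (rule that[of "min d 1"])
    show "\<bar>g y - g x\<bar> < e" if "\<bar>x\<bar> \<le> M" "\<bar>y - x\<bar> < min d 1" for x y
      using d(2)[of x y] that by (simp add: dist_real_def abs_le_iff abs_less_iff)
  qed (use d in auto)
qed

lemma real_MVT_unordered:
  fixes f :: "real \<Rightarrow> real"
  assumes "\<And>x. (f has_real_derivative f' x) (at x)"
  obtains z where "f y - f x = (y - x) * f' z" "\<bar>z - x\<bar> \<le> \<bar>y - x\<bar>"
proof (cases x y rule: linorder_cases)
  case less
  then show ?thesis using MVT2[OF less, of f f'] assms that by force
next
  case equal
  then show ?thesis using that[of x] by simp
next
  case greater
  then obtain z where "z > y" "z < x" "f x - f y = (x - y) * f' z"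
    using MVT2[OF greater, of f f'] assms by force
  then show ?thesis using that[of z] by (simp add: algebra_simps)
qed

lemma continuous_antiderivative:
  fixes g :: "real \<Rightarrow> real"
  assumes "continuous_on UNIV g"
  obtains F where "\<And>x. (F has_real_derivative g x) (at x)"
  using einterval_antiderivative[of "-\<infinity>" "\<infinity>" g] assms
  by (auto simp: continuous_on_eq_continuous_at has_real_derivative_iff_has_vector_derivative)

lemma abs_power_le_of_bound: "\<bar>s\<bar> \<le> M \<Longrightarrow> \<bar>s ^ k\<bar> \<le> (\<bar>M\<bar> + 1) ^ k" for s :: real
  unfolding power_abs by (rule power_mono) auto

text \<open>A linear space closed under uniform convergence on bounded intervals to continuous
  functions. The instance in \<open>approximable_shear\<close> consists of the functions that a
  network can add to one of its coordinates.\<close>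

locale closed_function_space =
  fixes V :: "(real \<Rightarrow> real) set"
  assumes add: "f \<in> V \<Longrightarrow> g \<in> V \<Longrightarrow> (\<lambda>s. f s + g s) \<in> V"
    and scale: "f \<in> V \<Longrightarrow> (\<lambda>s. c * f s) \<in> V"
    and limit: "continuous_on UNIV f \<Longrightarrow>
      (\<And>M e. e > 0 \<Longrightarrow> \<exists>g\<in>V. \<forall>s. \<bar>s\<bar> \<le> M \<longrightarrow> \<bar>g s - f s\<bar> < e) \<Longrightarrow> f \<in> V"
    and nonempty: "V \<noteq> {}"
begin

lemma zero: "(\<lambda>_. 0) \<in> V"
  using nonempty scale[of _ 0] by auto

lemma sum: "(\<And>i. i \<in> I \<Longrightarrow> f i \<in> V) \<Longrightarrow> (\<lambda>s. \<Sum>i\<in>I. f i s) \<in> V"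
  by (induction I rule: infinite_finite_induct) (auto intro: zero add)

text \<open>Models the \<open>k\<close>-th derivative in the slope: for smooth \<open>g\<close>,
  differentiating \<open>g (l * s + b)\<close> \<open>k\<close> times with respect to
  \<open>l\<close> gives \<open>s ^ k\<close> times the \<open>k\<close>-th derivative of
  \<open>g\<close>. Since \<rho> is only continuous, iterated differences will replace
  derivatives.\<close>

definition power_multiplier :: "nat \<Rightarrow> (real \<Rightarrow> real) \<Rightarrow> bool" where
  "power_multiplier k g \<longleftrightarrow>
     continuous_on UNIV g \<and> (\<forall>l b. (\<lambda>s. s ^ k * g (l * s + b)) \<in> V)"

text \<open>Riemann sums of \<open>\<integral>\<^sub>0\<^sup>h g(x + t) dt\<close>, written with an antiderivative of \<open>g\<close>.\<close>
lemma power_multiplier_shift_diff_antiderivative: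
  assumes g: "power_multiplier k g" and F: "\<And>x. (F has_real_derivative g x) (at x)"
  shows "power_multiplier k (shift_diff h F)"
  unfolding power_multiplier_def
proof (intro conjI allI)
  have contg: "continuous_on UNIV g" using g by (simp add: power_multiplier_def)
  have contF: "continuous_on UNIV F"
    using F DERIV_isCont by (auto simp: continuous_on_eq_continuous_at)
  show cont: "continuous_on UNIV (shift_diff h F)"
    using contF by (rule continuous_on_shift_diff)
  fix l b
  show "(\<lambda>s. s ^ k * shift_diff h F (l * s + b)) \<in> V"
  proof (rule limit)
    show "continuous_on UNIV (\<lambda>s. s ^ k * shift_diff h F (l * s + b))"
      using cont by (intro continuous_intros continuous_on_compose2[OF cont]) auto
  next
    fix M e :: real assume "e > 0"
    \<comment> \<open>A bound for \<open>\<bar>s ^ k\<bar>\<close> times the length of the interval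
      of integration; the 1 added to \<open>\<bar>h\<bar>\<close> keeps \<open>C\<close> positive
      and makes the last estimate strict.\<close>
    define C where "C = (\<bar>M\<bar> + 1) ^ k * (\<bar>h\<bar> + 1)"
    have "C > 0" unfolding C_def by (intro mult_pos_pos zero_less_power) auto
    obtain d where d: "d > 0"
      "\<And>x y. \<bar>x\<bar> \<le> \<bar>l\<bar> * \<bar>M\<bar> + \<bar>b\<bar> + \<bar>h\<bar> \<Longrightarrow> \<bar>y - x\<bar> < d \<Longrightarrow> \<bar>g y - g x\<bar> < e / C"
      using continuous_modulus[OF contg, of "e / C" "\<bar>l\<bar> * \<bar>M\<bar> + \<bar>b\<bar> + \<bar>h\<bar>"] \<open>C > 0\<close> \<open>e > 0\<close> by auto
    obtain N where N: "real N > \<bar>h\<bar> / d" using reals_Archimedean2 by blast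
    have "N > 0" using N d(1)
      by (metis abs_ge_zero divide_nonneg_pos gr0I not_less of_nat_0)
    define t where "t i = real i * (h / real N)" for i
    let ?G = "\<lambda>s. \<Sum>i<N. (h / real N) * (s ^ k * g (l * s + (b + t i)))"
    have "?G \<in> V"
      using g by (intro sum scale) (auto simp: power_multiplier_def)
    moreover have "\<bar>?G s - s ^ k * shift_diff h F (l * s + b)\<bar> < e" if s: "\<bar>s\<bar> \<le> M" for s
    proof -
      define x where "x = l * s + b"
      have x: "\<bar>x\<bar> \<le> \<bar>l\<bar> * \<bar>M\<bar> + \<bar>b\<bar>"
      proof -
        have "\<bar>x\<bar> \<le> \<bar>l * s\<bar> + \<bar>b\<bar>" by (simp add: x_def)
        moreover have "\<bar>l * s\<bar> \<le> \<bar>l\<bar> * \<bar>M\<bar>" using s by (auto simp: abs_mult intro!: mult_left_mono)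
        ultimately show ?thesis by simp
      qed
      have tel: "shift_diff h F x = (\<Sum>i<N. F (x + t (Suc i)) - F (x + t i))"
        using sum_lessThan_telescope[of "\<lambda>i. F (x + t i)" N] \<open>N > 0\<close>
        by (simp add: shift_diff_def t_def)
      \<comment> \<open>By the mean value theorem each increment of \<open>F\<close> is the mesh
        \<open>h / real N\<close> times a value of \<open>g\<close> at a point within one mesh of
        the sample point, and \<open>N\<close> was chosen to make the mesh smaller than
        \<open>d\<close>.\<close>
      have step: "\<bar>(h / real N) * g (x + t i) - (F (x + t (Suc i)) - F (x + t i))\<bar>
          \<le> \<bar>h\<bar> / real N * (e / C)" if "i < N" for i
      proof -
        obtain z where z: "F (x + t (Suc i)) - F (x + t i) = (x + t (Suc i) - (x + t i)) * g z"
          "\<bar>z - (x + t i)\<bar> \<le> \<bar>x + t (Suc i) - (x + t i)\<bar>"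
          using real_MVT_unordered[OF F] by blast
        have dt: "x + t (Suc i) - (x + t i) = h / real N" by (simp add: t_def distrib_right add_divide_distrib)
        have "\<bar>h / real N\<bar> < d" using N d(1) \<open>N > 0\<close> by (simp add: field_simps)
        moreover have "\<bar>t i\<bar> \<le> \<bar>h\<bar>"
          using that \<open>N > 0\<close> by (simp add: t_def abs_mult field_simps mult_mono)
        ultimately have "\<bar>g z - g (x + t i)\<bar> < e / C"
          using z(2)[unfolded dt] x by (intro d(2)) linarith+
        then have "\<bar>h / real N\<bar> * \<bar>g (x + t i) - g z\<bar> \<le> \<bar>h / real N\<bar> * (e / C)"
          by (intro mult_left_mono) auto
        then show ?thesis
          unfolding z(1) dt right_diff_distrib [symmetric] abs_mult by simp
      qed
      have "\<bar>(\<Sum>i<N. (h / real N) * g (x + t i)) - shift_diff h F x\<bar>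
          \<le> (\<Sum>i<N. \<bar>(h / real N) * g (x + t i) - (F (x + t (Suc i)) - F (x + t i))\<bar>)"
        unfolding tel sum_subtractf [symmetric] by (rule sum_abs)
      also have "\<dots> \<le> (\<Sum>i<N. \<bar>h\<bar> / real N * (e / C))"
        using step by (intro sum_mono) auto
      also have "\<dots> = \<bar>h\<bar> * (e / C)" using \<open>N > 0\<close> by simp
      finally have R: "\<bar>(\<Sum>i<N. (h / real N) * g (x + t i)) - shift_diff h F x\<bar> \<le> \<bar>h\<bar> * (e / C)" .
      have "?G s - s ^ k * shift_diff h F (l * s + b)
          = s ^ k * ((\<Sum>i<N. (h / real N) * g (x + t i)) - shift_diff h F x)"
        by (simp add: x_def right_diff_distrib sum_distrib_left mult_ac add_ac)
      then have "\<bar>?G s - s ^ k * shift_diff h F (l * s + b)\<bar>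
          \<le> (\<bar>M\<bar> + 1) ^ k * (\<bar>h\<bar> * (e / C))"
        using mult_mono[OF abs_power_le_of_bound[OF s, of k] R] by (simp add: abs_mult)
      also have "\<dots> < (\<bar>M\<bar> + 1) ^ k * ((\<bar>h\<bar> + 1) * (e / C))"
        using \<open>e > 0\<close> \<open>C > 0\<close> by (intro mult_strict_left_mono mult_strict_right_mono) auto
      also have "\<dots> = e" using \<open>C > 0\<close> by (simp add: C_def field_simps)
      finally show ?thesis .
    qed
    ultimately show "\<exists>g\<in>V. \<forall>s. \<bar>s\<bar> \<le> M \<longrightarrow> \<bar>g s - s ^ k * shift_diff h F (l * s + b)\<bar> < e"
      by (intro bexI[of _ ?G]) blast+
  qed
qed

text \<open>Differentiating \<open>G (l s + b)\<close> with respect to \<open>l\<close> produces the extra factor \<open>s\<close>.\<close>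
lemma power_multiplier_derivative:
  assumes G: "power_multiplier k G" and G': "\<And>x. (G has_real_derivative G' x) (at x)"
    and contG': "continuous_on UNIV G'"
  shows "power_multiplier (Suc k) G'"
  unfolding power_multiplier_def
proof (intro conjI allI contG')
  fix l b
  show "(\<lambda>s. s ^ Suc k * G' (l * s + b)) \<in> V"
  proof (rule limit)
    show "continuous_on UNIV (\<lambda>s. s ^ Suc k * G' (l * s + b))"
      by (intro continuous_intros continuous_on_compose2[OF contG']) auto
  next
    fix M e :: real assume "e > 0"
    define C where "C = (\<bar>M\<bar> + 1) ^ Suc k"
    have "C > 0" unfolding C_def by (intro zero_less_power) auto
    obtain d where d: "d > 0"
      "\<And>x y. \<bar>x\<bar> \<le> \<bar>l\<bar> * \<bar>M\<bar> + \<bar>b\<bar> \<Longrightarrow> \<bar>y - x\<bar> < d \<Longrightarrow> \<bar>G' y - G' x\<bar> < e / C"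
      using continuous_modulus[OF contG', of "e / C" "\<bar>l\<bar> * \<bar>M\<bar> + \<bar>b\<bar>"] \<open>C > 0\<close> \<open>e > 0\<close> by auto
    \<comment> \<open>The increment of the slope: for \<open>\<bar>s\<bar> \<le> M\<close> it moves
      the argument of \<open>G\<close> by less than \<open>d\<close>. The function \<open>?H\<close>
      is the corresponding difference quotient.\<close>
    define \<eta> where "\<eta> = d / (\<bar>M\<bar> + 1)"
    have "\<eta> > 0" using d(1) by (simp add: \<eta>_def field_simps)
    let ?H = "\<lambda>s. (1 / \<eta>) * (s ^ k * G ((l + \<eta>) * s + b) + (-1) * (s ^ k * G (l * s + b)))"
    have "?H \<in> V"
      using G by (intro scale add) (auto simp: power_multiplier_def)
    moreover have "\<bar>?H s - s ^ Suc k * G' (l * s + b)\<bar> < e" if s: "\<bar>s\<bar> \<le> M" for s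
    proof -
      define x where "x = l * s + b"
      have x: "\<bar>x\<bar> \<le> \<bar>l\<bar> * \<bar>M\<bar> + \<bar>b\<bar>"
      proof -
        have "\<bar>x\<bar> \<le> \<bar>l * s\<bar> + \<bar>b\<bar>" by (simp add: x_def)
        moreover have "\<bar>l * s\<bar> \<le> \<bar>l\<bar> * \<bar>M\<bar>" using s by (auto simp: abs_mult intro!: mult_left_mono)
        ultimately show ?thesis by simp
      qed
      obtain z where z: "G (x + \<eta> * s) - G x = (x + \<eta> * s - x) * G' z"
        "\<bar>z - x\<bar> \<le> \<bar>x + \<eta> * s - x\<bar>"
        using real_MVT_unordered[OF G'] by blast
      have "\<eta> * \<bar>s\<bar> < \<eta> * (\<bar>M\<bar> + 1)"
        using s \<open>\<eta> > 0\<close> by (intro mult_strict_left_mono) auto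
      then have "\<bar>z - x\<bar> < d"
        using z(2) \<open>\<eta> > 0\<close> d(1) by (simp add: \<eta>_def abs_mult)
      then have z': "\<bar>G' z - G' x\<bar> < e / C" using d(2) x by blast
      have "(l + \<eta>) * s + b = x + \<eta> * s" by (simp add: x_def algebra_simps)
      then have "?H s = (1 / \<eta>) * (s ^ k * (G (x + \<eta> * s) - G x))"
        by (simp only: x_def [symmetric]) (simp add: right_diff_distrib)
      also have "\<dots> = s ^ Suc k * G' z"
        using \<open>\<eta> > 0\<close> by (simp add: z(1))
      finally have "?H s - s ^ Suc k * G' (l * s + b) = s ^ Suc k * (G' z - G' x)"
        by (simp add: x_def right_diff_distrib)
      then have "\<bar>?H s - s ^ Suc k * G' (l * s + b)\<bar> \<le> C * \<bar>G' z - G' x\<bar>"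
        using mult_right_mono[OF abs_power_le_of_bound[OF s, of "Suc k"], of "\<bar>G' z - G' x\<bar>"]
        by (simp only: abs_mult C_def abs_ge_zero)
      also have "\<dots> < C * (e / C)"
        using z' \<open>C > 0\<close> by (intro mult_strict_left_mono)
      finally show ?thesis using \<open>C > 0\<close> by simp
    qed
    ultimately show "\<exists>g\<in>V. \<forall>s. \<bar>s\<bar> \<le> M \<longrightarrow> \<bar>g s - s ^ Suc k * G' (l * s + b)\<bar> < e"
      by (intro bexI[of _ ?H]) blast+
  qed
qed

text \<open>With \<open>F\<close> an antiderivative of \<open>g\<close>, the function
  \<open>shift_diff h F\<close> is a sliding integral of \<open>g\<close> and has the continuous
  derivative \<open>shift_diff h g\<close>. Integration keeps the power \<open>k\<close>, and
  differentiation in the slope raises it by one.\<close>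

lemma power_multiplier_shift_diff:
  assumes "power_multiplier k g"
  shows "power_multiplier (Suc k) (shift_diff h g)"
proof -
  have contg: "continuous_on UNIV g" using assms by (simp add: power_multiplier_def)
  obtain F where F: "\<And>x. (F has_real_derivative g x) (at x)"
    using continuous_antiderivative[OF contg] by blast
  have "(shift_diff h F has_real_derivative shift_diff h g x) (at x)" for x
    unfolding shift_diff_def using F DERIV_shift[of F "g (x + h)" x h]
    by (intro derivative_intros) simp_all
  then show ?thesis
    using power_multiplier_derivative power_multiplier_shift_diff_antiderivative[OF assms F]
      continuous_on_shift_diff[OF contg] by blast
qed

text \<open>Each difference raises the power by one. After \<open>j\<close> suitable steps a
  function with a nonzero value at some \<open>b\<close> remains, and slope 0 turns it into a
  nonzero constant, leaving a multiple of the monomial.\<close>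

lemma power_mem:
  assumes "power_multiplier k g" "\<not> differences_vanish j g"
  shows "(\<lambda>s. s ^ (k + j)) \<in> V"
  using assms
proof (induction j arbitrary: k g)
  case 0
  then obtain b where b: "g b \<noteq> 0" by auto
  have "(\<lambda>s. s ^ k * g (0 * s + b)) \<in> V"
    using "0.prems"(1) unfolding power_multiplier_def by blast
  then have "(\<lambda>s. (1 / g b) * (s ^ k * g (0 * s + b))) \<in> V" by (rule scale)
  then show ?case using b by simp
next
  case (Suc j)
  then obtain h where "\<not> differences_vanish j (shift_diff h g)" by auto
  then show ?case
    using Suc.IH[OF power_multiplier_shift_diff[OF Suc.prems(1)]] by simp
qed

text \<open>As \<rho> is not a polynomial, no order of differences annihilates it, so all monomials
  lie in \<open>V\<close>; Weierstrass approximation does the rest.\<close>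

theorem nonpolynomial_generates:
  assumes cont: "continuous_on UNIV \<rho>" and nonpoly: "\<not> (\<exists>q. \<forall>x. \<rho> x = poly q x)"
    and mem: "\<And>l b. (\<lambda>s. \<rho> (l * s + b)) \<in> V"
    and f: "continuous_on UNIV f"
  shows "f \<in> V"
proof (rule limit[OF f])
  fix M e :: real assume "e > 0"
  have "power_multiplier 0 \<rho>"
    using cont mem by (simp add: power_multiplier_def)
  then have pow: "(\<lambda>s. s ^ k) \<in> V" for k
    using power_mem[of 0 \<rho> k] differences_vanish_imp_poly[OF cont, of k] nonpoly by auto
  obtain g where g: "real_polynomial_function g" "\<And>x. x \<in> {-M..M} \<Longrightarrow> \<bar>f x - g x\<bar> < e"
    using Stone_Weierstrass_real_polynomial_function[of "{-M..M}" f e]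
      continuous_on_subset[OF f, of "{-M..M}"] \<open>e > 0\<close> by blast
  then obtain a n where "g = (\<lambda>x. \<Sum>i\<le>n. a i * x ^ i)"
    unfolding real_polynomial_function_iff_sum by blast
  then have "g \<in> V" by (auto intro!: sum scale pow)
  then show "\<exists>g\<in>V. \<forall>s. \<bar>s\<bar> \<le> M \<longrightarrow> \<bar>g s - f s\<bar> < e"
    using g(2) by (auto simp: abs_le_iff abs_minus_commute intro!: bexI[of _ g])
qed

end

section \<open>Uniform approximation by networks\<close>

lemma affine_hidden_compose:
  "affine_hidden w A b (affine_hidden w A' b' h) =
     affine_hidden w (\<lambda>j k. \<Sum>i<w. A j i * A' i k) (\<lambda>j. (\<Sum>i<w. A j i * b' i) + b j) h"
proof
  fix j
  have "(\<Sum>i<w. A j i * (\<Sum>k<w. A' i k * h k)) = (\<Sum>k<w. (\<Sum>i<w. A j i * A' i k) * h k)"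
    unfolding sum_distrib_left sum_distrib_right by (subst sum.swap) (simp only: mult.assoc)
  then show "affine_hidden w A b (affine_hidden w A' b' h) j =
      affine_hidden w (\<lambda>j k. \<Sum>i<w. A j i * A' i k) (\<lambda>j. (\<Sum>i<w. A j i * b' i) + b j) h j"
    by (simp add: affine_hidden_def distrib_left sum.distrib)
qed

lemma affine_hidden_diagonal:
  "j < w \<Longrightarrow> affine_hidden w (\<lambda>j i. if i = j then c j else 0) b h j = c j * h j + b j"
  by (simp add: affine_hidden_def if_distrib[of "\<lambda>u. u * _"] cong: if_cong)

text \<open>For \<open>t \<noteq> 0\<close> the error is \<open>t / D\<close> times the error of the
  ordinary difference quotient at step \<open>\<eta> * t\<close>. A small \<eta> makes all these
  steps small at once, as \<open>t\<close> is bounded.\<close>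

lemma difference_quotient_approx_id:
  fixes \<rho> :: "real \<Rightarrow> real"
  assumes "(\<rho> has_real_derivative D) (at z)" "D \<noteq> 0" "e > 0"
  obtains \<eta> where "\<eta> > 0" "\<And>t. \<bar>t\<bar> \<le> M \<Longrightarrow> \<bar>(\<rho> (\<eta> * t + z) - \<rho> z) / (\<eta> * D) - t\<bar> < e"
proof -
  define e' where "e' = e * \<bar>D\<bar> / (\<bar>M\<bar> + 1)"
  have e': "e' > 0" using assms by (simp add: e'_def)
  have "((\<lambda>h. (\<rho> (z + h) - \<rho> z) / h) \<longlongrightarrow> D) (at 0)"
    using assms(1) by (simp add: DERIV_def)
  then obtain d where d: "d > 0"
    "\<And>h. h \<noteq> 0 \<Longrightarrow> \<bar>h\<bar> < d \<Longrightarrow> \<bar>(\<rho> (z + h) - \<rho> z) / h - D\<bar> < e'"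
    using e' by (auto simp: LIM_eq)
  define \<eta> where "\<eta> = d / (\<bar>M\<bar> + 1)"
  have \<eta>: "\<eta> > 0" using d by (simp add: \<eta>_def)
  show ?thesis
  proof (rule that[OF \<eta>])
    fix t assume t: "\<bar>t\<bar> \<le> M"
    show "\<bar>(\<rho> (\<eta> * t + z) - \<rho> z) / (\<eta> * D) - t\<bar> < e"
    proof (cases "t = 0")
      case False
      have "\<eta> * \<bar>t\<bar> < \<eta> * (\<bar>M\<bar> + 1)"
        using t \<eta> by (intro mult_strict_left_mono) auto
      then have "\<bar>\<eta> * t\<bar> < d" using \<eta> d(1) by (simp add: \<eta>_def abs_mult)
      then have *: "\<bar>(\<rho> (z + \<eta> * t) - \<rho> z) / (\<eta> * t) - D\<bar> < e'"
        using d(2)[of "\<eta> * t"] False \<eta> by simp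
      have "(\<rho> (\<eta> * t + z) - \<rho> z) / (\<eta> * D) - t = (t / D) * ((\<rho> (z + \<eta> * t) - \<rho> z) / (\<eta> * t) - D)"
        using False \<eta> assms(2) by (simp add: field_simps)
      then have "\<bar>(\<rho> (\<eta> * t + z) - \<rho> z) / (\<eta> * D) - t\<bar>
          = (\<bar>t\<bar> / \<bar>D\<bar>) * \<bar>(\<rho> (z + \<eta> * t) - \<rho> z) / (\<eta> * t) - D\<bar>"
        by (simp add: abs_mult)
      also have "\<dots> < (\<bar>t\<bar> / \<bar>D\<bar>) * e'"
        using False assms(2) * by (intro mult_strict_left_mono) auto
      also have "\<dots> \<le> ((\<bar>M\<bar> + 1) / \<bar>D\<bar>) * e'"
        using t e' by (intro mult_right_mono divide_right_mono) auto
      also have "\<dots> = e" using assms(2) by (simp add: e'_def)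
      finally show ?thesis .
    qed (use assms(3) in simp)
  qed
qed

text \<open>The span of the exponentials of linear forms. Building it one term at a time lets a
  network add one term per shear, and the product rule for exponentials makes it an algebra, as
  Stone-Weierstrass requires.\<close>

inductive_set exp_sums :: "('a::real_inner \<Rightarrow> real) set" where
  zero: "(\<lambda>_. 0) \<in> exp_sums"
| add_exp: "f \<in> exp_sums \<Longrightarrow> (\<lambda>x. f x + c * exp (a \<bullet> x)) \<in> exp_sums"

lemma exp_sums_add: "g \<in> exp_sums \<Longrightarrow> f \<in> exp_sums \<Longrightarrow> (\<lambda>x. f x + g x) \<in> exp_sums"
proof (induction rule: exp_sums.induct)
  case (add_exp g c a)
  then show ?case
    using exp_sums.add_exp[of "\<lambda>x. f x + g x" c a] by (simp add: add.assoc)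
qed simp

lemma exp_sums_mult_exp:
  "f \<in> exp_sums \<Longrightarrow> (\<lambda>x. f x * (c * exp (a \<bullet> x))) \<in> exp_sums"
proof (induction rule: exp_sums.induct)
  case (add_exp f c' a')
  have "(\<lambda>x. f x * (c * exp (a \<bullet> x)) + (c' * c) * exp ((a' + a) \<bullet> x)) \<in> exp_sums"
    by (rule exp_sums.add_exp) (rule add_exp.IH)
  then show ?case
    by (simp add: inner_add_left exp_add algebra_simps)
qed (simp add: exp_sums.zero)

lemma exp_sums_mult: "g \<in> exp_sums \<Longrightarrow> f \<in> exp_sums \<Longrightarrow> (\<lambda>x. f x * g x) \<in> exp_sums"
proof (induction rule: exp_sums.induct)
  case (add_exp g c a)
  then show ?case
    using exp_sums_add[OF exp_sums_mult_exp[of f c a]] by (simp add: distrib_left)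
qed (simp add: exp_sums.zero)

lemma exp_sums_const: "(\<lambda>_. c) \<in> exp_sums"
  using exp_sums.add_exp[OF exp_sums.zero, of c 0] by simp

lemma exp_sums_dense:
  fixes f :: "'a::real_inner \<Rightarrow> real"
  assumes "compact K" "continuous_on K f" "e > 0"
  obtains g where "g \<in> exp_sums" "\<And>x. x \<in> K \<Longrightarrow> \<bar>f x - g x\<bar> < e"
proof -
  have "\<exists>g. g \<in> exp_sums \<and> (\<forall>x\<in>K. \<bar>f x - g x\<bar> < e)"
  proof (rule Stone_Weierstrass_HOL[OF assms(1)])
    show "continuous_on K g" if "g \<in> exp_sums" for g :: "'a \<Rightarrow> real"
      using that by induction (auto intro!: continuous_intros)
    show "\<exists>f. f \<in> exp_sums \<and> f x \<noteq> f y" if "x \<in> K \<and> y \<in> K \<and> x \<noteq> y" for x y :: 'a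
    proof (intro exI conjI)
      \<comment> \<open>This exponential separates \<open>x\<close> from \<open>y\<close> because
        its exponents there differ by \<open>(x - y) \<bullet> (x - y)\<close>.\<close>
      show "(\<lambda>u. 0 + 1 * exp ((x - y) \<bullet> u)) \<in> exp_sums"
        by (intro exp_sums.intros)
      have "(x - y) \<bullet> (x - y) \<noteq> 0" using that by simp
      then show "0 + 1 * exp ((x - y) \<bullet> x) \<noteq> 0 + 1 * exp ((x - y) \<bullet> y)"
        by (simp add: inner_diff_right)
    qed
  qed (use assms exp_sums_const exp_sums_add exp_sums_mult in auto)
  then show ?thesis using that by blast
qed

section \<open>Networks of constant width \<open>w\<close> and their uniform limits on
  \<open>K\<close>\<close>

locale rho_networks =
  fixes \<rho> :: "real \<Rightarrow> real" and z D :: real and w :: nat and K :: "(real^'n) set"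
  assumes cont_rho: "continuous_on UNIV \<rho>"
    and nonpoly: "\<not> (\<exists>q. \<forall>x. \<rho> x = poly q x)"
    and deriv_rho: "(\<rho> has_real_derivative D) (at z)" "D \<noteq> 0"
    and compact_K: "compact K"
    and w_pos: "w > 0"
begin

inductive_set hidden :: "(real^'n \<Rightarrow> nat \<Rightarrow> real) set" where
  first_layer: "(\<lambda>x j. \<rho> ((\<Sum>i\<in>UNIV. A j i * x $ i) + b j)) \<in> hidden"
| next_layer: "h \<in> hidden \<Longrightarrow> (\<lambda>x j. \<rho> (affine_hidden w A b (h x) j)) \<in> hidden"

text \<open>States are taken one affine map after the last activation: this class is closed under
  further affine maps, applying \<rho> to all coordinates leads back to \<open>hidden\<close>, and
  selecting coordinates yields the output of a network.\<close>

definition preactivations :: "(real^'n \<Rightarrow> nat \<Rightarrow> real) set" where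
  "preactivations = {\<lambda>x. affine_hidden w A b (h x) | A b h. h \<in> hidden}"

text \<open>The bound confines the arguments of \<rho> to a compact interval, on which \<rho> is
  uniformly continuous, so that errors stay controlled through further layers.\<close>

definition approximable :: "(real^'n \<Rightarrow> nat \<Rightarrow> real) \<Rightarrow> bool" where
  "approximable H \<longleftrightarrow> (\<exists>B. \<forall>x\<in>K. \<forall>i<w. \<bar>H x i\<bar> \<le> B) \<and>
     (\<forall>e>0. \<exists>N\<in>preactivations. \<forall>x\<in>K. \<forall>i<w. \<bar>N x i - H x i\<bar> < e)"

text \<open>Links the inductive description to the fold in \<open>nn_eval\<close>. A new layer acts
  last, so it is appended at the right end of \<open>Ms\<close>.\<close>

lemma hidden_eq_foldl:
  assumes "h \<in> hidden"
  shows "\<exists>A1 b1 Ms. h = (\<lambda>x. foldl (\<lambda>h (din, (A, b)). (\<lambda>j. \<rho> (affine_hidden din A b h j)))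
           (\<lambda>j. \<rho> ((\<Sum>i\<in>UNIV. A1 j i * x $ i) + b1 j)) (zip (replicate (length Ms) w) Ms))"
  using assms
proof induction
  case (first_layer A b)
  show ?case by (rule exI[of _ A], rule exI[of _ b], rule exI[of _ "[]"]) simp
next
  case (next_layer h A b)
  then obtain A1 b1 Ms where h: "h = (\<lambda>x. foldl (\<lambda>h (din, (A, b)). (\<lambda>j. \<rho> (affine_hidden din A b h j)))
           (\<lambda>j. \<rho> ((\<Sum>i\<in>UNIV. A1 j i * x $ i) + b1 j)) (zip (replicate (length Ms) w) Ms))"
    by blast
  have "zip (replicate (length (Ms @ [(A, b)])) w) (Ms @ [(A, b)])
      = zip (replicate (length Ms) w) Ms @ [(w, (A, b))]"
    by (simp only: length_append list.size add_0_right add_Suc_right replicate_Suc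
        replicate_append_same [symmetric]) simp
  then show ?case
    by (intro exI[of _ A1] exI[of _ b1] exI[of _ "Ms @ [(A, b)]"]) (simp add: h)
qed

text \<open>The output layer consists of the rows \<open>ind k\<close> of the last affine map, and
  every hidden layer has dimension exactly \<open>w\<close>.\<close>

lemma preactivation_is_net:
  fixes ind :: "'m::finite \<Rightarrow> nat"
  assumes "N \<in> preactivations"
  shows "is_rho_net_of_width \<rho> w (\<lambda>x. \<chi> k. N x (ind k))"
proof -
  obtain A b h where N: "N = (\<lambda>x. affine_hidden w A b (h x))" and h: "h \<in> hidden"
    using assms by (auto simp: preactivations_def)
  obtain A1 b1 Ms where h: "h = (\<lambda>x. foldl (\<lambda>h (din, (A, b)). (\<lambda>j. \<rho> (affine_hidden din A b h j)))
           (\<lambda>j. \<rho> ((\<Sum>i\<in>UNIV. A1 j i * x $ i) + b1 j)) (zip (replicate (length Ms) w) Ms))"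
    using hidden_eq_foldl[OF h] by blast
  show ?thesis
    unfolding is_rho_net_of_width_def
  proof (intro exI conjI)
    let ?dims = "replicate (Suc (length Ms)) w"
    show "?dims \<noteq> []" "length Ms = length ?dims - 1" "Max (set ?dims) = w"
      by (auto simp del: replicate.simps simp: set_replicate_Suc)
    have "butlast ?dims = replicate (length Ms) w" "last ?dims = w"
      by (simp_all add: butlast_conv_take take_replicate del: replicate.simps)
    then show "(\<lambda>x. \<chi> k. N x (ind k)) = nn_eval \<rho> ?dims A1 b1 Ms (\<lambda>k. A (ind k)) (\<chi> k. b (ind k))"
      unfolding nn_eval_def Let_def by (simp add: N h affine_hidden_def del: replicate.simps)
  qed
qed

lemma continuous_on_rho: "continuous_on S f \<Longrightarrow> continuous_on S (\<lambda>x. \<rho> (f x))"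
  by (rule continuous_on_compose2[OF cont_rho]) auto

lemma continuous_on_hidden: "h \<in> hidden \<Longrightarrow> continuous_on UNIV (\<lambda>x. h x j)"
  by (induction arbitrary: j rule: hidden.induct)
    (auto simp: affine_hidden_def intro!: continuous_on_rho continuous_intros)

lemma continuous_on_preactivation:
  assumes "N \<in> preactivations"
  shows "continuous_on UNIV (\<lambda>x. N x j)"
proof -
  obtain A b h where N: "N = (\<lambda>x. affine_hidden w A b (h x))" and h: "h \<in> hidden"
    using assms by (auto simp: preactivations_def)
  show ?thesis
    unfolding N affine_hidden_def by (intro continuous_intros continuous_on_hidden[OF h])
qed

lemma preactivations_affine:
  "N \<in> preactivations \<Longrightarrow> (\<lambda>x. affine_hidden w A b (N x)) \<in> preactivations"
  unfolding preactivations_def by (fastforce simp: affine_hidden_compose)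

lemma hidden_of_preactivations:
  "N \<in> preactivations \<Longrightarrow> (\<lambda>x j. \<rho> (N x j)) \<in> hidden"
  unfolding preactivations_def by (auto intro: next_layer)

lemma approximable_bound:
  assumes "approximable H"
  obtains B where "B \<ge> 0" "\<And>x i. x \<in> K \<Longrightarrow> i < w \<Longrightarrow> \<bar>H x i\<bar> \<le> B"
proof -
  obtain B where "\<And>x i. x \<in> K \<Longrightarrow> i < w \<Longrightarrow> \<bar>H x i\<bar> \<le> B"
    using assms unfolding approximable_def by blast
  then show ?thesis using that[of "\<bar>B\<bar>"] by force
qed

lemma approximable_limit:
  assumes "\<And>e. e > 0 \<Longrightarrow> \<exists>G. approximable G \<and> (\<forall>x\<in>K. \<forall>i<w. \<bar>G x i - H x i\<bar> < e)"
  shows "approximable H"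
  unfolding approximable_def
proof (intro conjI allI impI)
  obtain G where G: "approximable G" "\<forall>x\<in>K. \<forall>i<w. \<bar>G x i - H x i\<bar> < 1"
    using assms[of 1] by auto
  obtain B where B: "\<And>x i. x \<in> K \<Longrightarrow> i < w \<Longrightarrow> \<bar>G x i\<bar> \<le> B"
    using approximable_bound[OF G(1)] by blast
  have "\<bar>H x i\<bar> \<le> B + 1" if "x \<in> K" "i < w" for x i
    using B[OF that] G(2) that by (auto dest!: bspec spec[of _ i])
  then show "\<exists>B. \<forall>x\<in>K. \<forall>i<w. \<bar>H x i\<bar> \<le> B" by blast
next
  fix e :: real assume "e > 0"
  then obtain G where G: "approximable G" "\<forall>x\<in>K. \<forall>i<w. \<bar>G x i - H x i\<bar> < e / 2"
    using assms[of "e / 2"] by auto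
  obtain N where N: "N \<in> preactivations" "\<forall>x\<in>K. \<forall>i<w. \<bar>N x i - G x i\<bar> < e / 2"
    using G(1) \<open>e > 0\<close> unfolding approximable_def by (meson half_gt_zero)
  have "\<bar>N x i - H x i\<bar> < e" if "x \<in> K" "i < w" for x i
    using G(2) N(2) that by (smt (verit) field_sum_of_halves)
  then show "\<exists>N\<in>preactivations. \<forall>x\<in>K. \<forall>i<w. \<bar>N x i - H x i\<bar> < e"
    using N(1) by blast
qed

lemma approximable_affine:
  assumes H: "approximable H"
    and H': "\<And>x j. x \<in> K \<Longrightarrow> j < w \<Longrightarrow> H' x j = (\<Sum>i<w. A j i * H x i) + b j"
  shows "approximable H'"
  unfolding approximable_def
proof (intro conjI allI impI)
  \<comment> \<open>\<open>C - 1\<close> bounds every absolute row sum of \<open>A\<close>; the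
    extra 1 permits division by \<open>C\<close> and makes the final estimate strict.\<close>
  define C where "C = (\<Sum>j<w. \<Sum>i<w. \<bar>A j i\<bar>) + 1"
  have row: "(\<Sum>i<w. \<bar>A j i\<bar>) \<le> C - 1" if "j < w" for j
    unfolding C_def using that by (auto intro!: member_le_sum sum_nonneg)
  have "C > 0" unfolding C_def by (intro add_nonneg_pos sum_nonneg) auto
  have bnd: "\<bar>\<Sum>i<w. A j i * v i\<bar> \<le> (C - 1) * M" if "j < w" "\<And>i. i < w \<Longrightarrow> \<bar>v i\<bar> \<le> M" "M \<ge> 0" for j v M
  proof -
    have "\<bar>\<Sum>i<w. A j i * v i\<bar> \<le> (\<Sum>i<w. \<bar>A j i\<bar> * M)"
      using that by (intro order_trans[OF sum_abs] sum_mono) (auto simp: abs_mult intro!: mult_left_mono)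
    also have "\<dots> \<le> (C - 1) * M"
      using row[OF that(1)] that(3) by (simp add: sum_distrib_right [symmetric] mult_right_mono)
    finally show ?thesis .
  qed
  obtain B where B: "B \<ge> 0" "\<And>x i. x \<in> K \<Longrightarrow> i < w \<Longrightarrow> \<bar>H x i\<bar> \<le> B"
    using approximable_bound[OF H] by blast
  have "\<bar>H' x j\<bar> \<le> (C - 1) * B + (\<Sum>j<w. \<bar>b j\<bar>)" if "x \<in> K" "j < w" for x j
  proof -
    have "\<bar>b j\<bar> \<le> (\<Sum>j<w. \<bar>b j\<bar>)" using that by (intro member_le_sum) auto
    then show ?thesis using bnd[of j "H x" B] B that H' by fastforce
  qed
  then show "\<exists>B. \<forall>x\<in>K. \<forall>i<w. \<bar>H' x i\<bar> \<le> B" by blast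
  fix e :: real assume "e > 0"
  then obtain N where N: "N \<in> preactivations" "\<And>x i. x \<in> K \<Longrightarrow> i < w \<Longrightarrow> \<bar>N x i - H x i\<bar> < e / C"
    using H \<open>C > 0\<close> unfolding approximable_def by (meson divide_pos_pos)
  have "\<bar>affine_hidden w A b (N x) j - H' x j\<bar> < e" if "x \<in> K" "j < w" for x j
  proof -
    have "affine_hidden w A b (N x) j - H' x j = (\<Sum>i<w. A j i * (N x i - H x i))"
      using that by (simp add: affine_hidden_def H' right_diff_distrib sum_subtractf)
    also have "\<bar>\<dots>\<bar> \<le> (C - 1) * (e / C)"
      using N(2) that \<open>e > 0\<close> \<open>C > 0\<close> by (intro bnd) (auto intro: less_imp_le)
    also have "\<dots> < e" using \<open>e > 0\<close> \<open>C > 0\<close> by (simp add: field_simps)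
    finally show ?thesis .
  qed
  then show "\<exists>N\<in>preactivations. \<forall>x\<in>K. \<forall>i<w. \<bar>N x i - H' x i\<bar> < e"
    by (intro bexI[OF _ preactivations_affine[OF N(1), of A b]]) blast
qed

lemma approximable_cong:
  assumes "approximable H" "\<And>x j. x \<in> K \<Longrightarrow> j < w \<Longrightarrow> H' x j = H x j"
  shows "approximable H'"
  using assms by (simp add: approximable_def)


lemma approximableI:
  assumes "\<And>j. j < w \<Longrightarrow> \<exists>B. \<forall>x\<in>K. \<bar>H x j\<bar> \<le> B"
    and "\<And>e. e > 0 \<Longrightarrow> \<exists>N\<in>preactivations. \<forall>x\<in>K. \<forall>i<w. \<bar>N x i - H x i\<bar> < e"
  shows "approximable H"
proof -
  obtain B where B: "\<And>j x. j < w \<Longrightarrow> x \<in> K \<Longrightarrow> \<bar>H x j\<bar> \<le> B j"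
    using assms(1) by metis
  have "\<bar>H x j\<bar> \<le> (\<Sum>i<w. \<bar>B i\<bar>)" if "j < w" "x \<in> K" for j x
    using B[OF that] member_le_sum[of j "{..<w}" "\<lambda>i. \<bar>B i\<bar>"] that(1) by auto
  then show ?thesis unfolding approximable_def using assms(2) by blast
qed

lemma preactivations_diagonal:
  assumes "h \<in> hidden"
  obtains N where "N \<in> preactivations" "\<And>x j. j < w \<Longrightarrow> N x j = c j * h x j + b j"
  using that[of "\<lambda>x. affine_hidden w (\<lambda>j i. if i = j then c j else 0) b (h x)"] assms
  unfolding preactivations_def by (fastforce simp: affine_hidden_diagonal)

text \<open>All coordinates except 0 are passed on by means of the difference quotient of \<open>\<rho>\<close> at \<open>z\<close>.\<close>
lemma approximable_rho:
  assumes H: "approximable H"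
  shows "approximable (\<lambda>x. (H x)(0 := \<rho> (H x 0)))"
proof (rule approximableI)
  obtain B where B: "B \<ge> 0" "\<And>x i. x \<in> K \<Longrightarrow> i < w \<Longrightarrow> \<bar>H x i\<bar> \<le> B"
    using approximable_bound[OF H] by blast
  have "compact (\<rho> ` {-B..B})"
    using cont_rho by (intro compact_continuous_image) (auto elim: continuous_on_subset)
  then obtain B' where B': "\<And>s. s \<in> {-B..B} \<Longrightarrow> \<bar>\<rho> s\<bar> \<le> B'"
    by (force dest!: compact_imp_bounded simp: bounded_iff)
  show "\<exists>B. \<forall>x\<in>K. \<bar>((H x)(0 := \<rho> (H x 0))) j\<bar> \<le> B" if "j < w" for j
  proof (cases "j = 0")
    case True
    have "\<forall>x\<in>K. H x 0 \<in> {-B..B}"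
      using B(2) w_pos by (force simp: abs_le_iff)
    then show ?thesis using B' True by auto
  qed (use B that in auto)
  fix e :: real assume "e > 0"
  obtain \<eta> where \<eta>: "\<eta> > 0"
    "\<And>t. \<bar>t\<bar> \<le> B + 1 \<Longrightarrow> \<bar>(\<rho> (\<eta> * t + z) - \<rho> z) / (\<eta> * D) - t\<bar> < e / 2"
    using difference_quotient_approx_id[OF deriv_rho, of "e / 2" "B + 1"] \<open>e > 0\<close> by auto
  obtain d where d: "d > 0" "\<And>s t. \<bar>s\<bar> \<le> B \<Longrightarrow> \<bar>t - s\<bar> < d \<Longrightarrow> \<bar>\<rho> t - \<rho> s\<bar> < e"
    using continuous_modulus[OF cont_rho \<open>e > 0\<close>, of B] by blast
  \<comment> \<open>Here \<open>d\<close> controls the error of \<rho> in coordinate 0, 1 keeps the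
    approximating state within the range \<open>B + 1\<close> chosen for \<eta>, and
    \<open>e / 2\<close> leaves the other half of \<open>e\<close> to the difference
    quotient.\<close>
  define d' where "d' = min (min d 1) (e / 2)"
  have "d' > 0" using d \<open>e > 0\<close> by (simp add: d'_def)
  then obtain N where N: "N \<in> preactivations" "\<And>x i. x \<in> K \<Longrightarrow> i < w \<Longrightarrow> \<bar>N x i - H x i\<bar> < d'"
    using H unfolding approximable_def by meson
  \<comment> \<open>Coordinate 0 enters \<rho> unchanged; the others are scaled by \<eta> and moved
    to \<open>z\<close>, which the affine map producing \<open>N'\<close> undoes after the
    activation.\<close>
  define h where "h = (\<lambda>x j. \<rho> (affine_hidden w (\<lambda>j i. if i = j then (if j = 0 then 1 else \<eta>) else 0)
      (\<lambda>j. if j = 0 then 0 else z) (N x) j))"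
  have h: "h x j = \<rho> (if j = 0 then N x 0 else \<eta> * N x j + z)" if "j < w" for x j
    unfolding h_def affine_hidden_diagonal[OF that] by simp
  have "h \<in> hidden"
    unfolding h_def by (intro hidden_of_preactivations preactivations_affine N(1))
  then obtain N' where N': "N' \<in> preactivations"
    "\<And>x j. j < w \<Longrightarrow> N' x j = (if j = 0 then 1 else 1 / (\<eta> * D)) * h x j + (if j = 0 then 0 else - \<rho> z / (\<eta> * D))"
    using preactivations_diagonal[where c = "\<lambda>j. if j = 0 then 1 else 1 / (\<eta> * D)"
        and b = "\<lambda>j. if j = 0 then 0 else - \<rho> z / (\<eta> * D)"] by blast
  have "\<bar>N' x i - ((H x)(0 := \<rho> (H x 0))) i\<bar> < e" if "x \<in> K" "i < w" for x i
  proof (cases "i = 0")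
    case True
    have "\<bar>\<rho> (N x i) - \<rho> (H x i)\<bar> < e"
      using N(2)[OF that] B(2)[OF that] by (intro d(2)) (auto simp: d'_def)
    then show ?thesis using True that by (simp add: N' h)
  next
    case False
    have N_bnd: "\<bar>N x i\<bar> \<le> B + 1" "\<bar>N x i - H x i\<bar> < e / 2"
      using N(2)[OF that] B(2)[OF that] by (auto simp: d'_def)
    have "N' x i = (\<rho> (\<eta> * N x i + z) - \<rho> z) / (\<eta> * D)"
      using False that by (simp add: N' h diff_divide_distrib)
    then have "\<bar>N' x i - N x i\<bar> < e / 2"
      using \<eta>(2)[OF N_bnd(1)] by simp
    then have "\<bar>N' x i - H x i\<bar> < e"
      using N_bnd(2) by linarith
    then show ?thesis using False by simp
  qed
  then show "\<exists>N\<in>preactivations. \<forall>x\<in>K. \<forall>i<w. \<bar>N x i - ((H x)(0 := \<rho> (H x 0))) i\<bar> < e"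
    using N'(1) by blast
qed

text \<open>The start of the construction: the first layer reads the input, and here every
  coordinate, 0 included, passes through the difference quotient.\<close>

lemma approximable_linear:
  "approximable (\<lambda>x j. \<Sum>i\<in>UNIV. a j i * x $ i)"
proof (rule approximableI)
  let ?s = "\<lambda>j x. \<Sum>i\<in>UNIV. a j i * x $ i"
  have bdd: "\<exists>B. \<forall>x\<in>K. \<bar>?s j x\<bar> \<le> B" for j
  proof -
    have "compact (?s j ` K)"
      by (intro compact_continuous_image compact_K continuous_intros)
    then show ?thesis by (force dest!: compact_imp_bounded simp: bounded_iff)
  qed
  then show "\<exists>B. \<forall>x\<in>K. \<bar>?s j x\<bar> \<le> B" for j .
  obtain B where B: "\<And>j x. x \<in> K \<Longrightarrow> \<bar>?s j x\<bar> \<le> B j"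
    using bdd by metis
  fix e :: real assume "e > 0"
  obtain \<eta> where \<eta>: "\<eta> > 0"
    "\<And>t. \<bar>t\<bar> \<le> (\<Sum>i<w. \<bar>B i\<bar>) \<Longrightarrow> \<bar>(\<rho> (\<eta> * t + z) - \<rho> z) / (\<eta> * D) - t\<bar> < e"
    using difference_quotient_approx_id[OF deriv_rho \<open>e > 0\<close>] by blast
  have "(\<lambda>x j. \<rho> ((\<Sum>i\<in>UNIV. (\<eta> * a j i) * x $ i) + z)) \<in> hidden"
    by (rule first_layer)
  then have "(\<lambda>x j. \<rho> (\<eta> * ?s j x + z)) \<in> hidden"
    by (simp add: sum_distrib_left mult.assoc)
  then obtain N where N: "N \<in> preactivations"
    "\<And>x j. j < w \<Longrightarrow> N x j = (1 / (\<eta> * D)) * \<rho> (\<eta> * ?s j x + z) + - \<rho> z / (\<eta> * D)"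
    using preactivations_diagonal[where c = "\<lambda>_. 1 / (\<eta> * D)" and b = "\<lambda>_. - \<rho> z / (\<eta> * D)"] by blast
  have "\<bar>N x j - ?s j x\<bar> < e" if "x \<in> K" "j < w" for x j
  proof -
    have "\<bar>?s j x\<bar> \<le> (\<Sum>i<w. \<bar>B i\<bar>)"
      using B[OF that(1), of j] member_le_sum[of j "{..<w}" "\<lambda>i. \<bar>B i\<bar>"] that(2) by auto
    then show ?thesis
      using \<eta>(2)[of "?s j x"] that by (simp add: N diff_divide_distrib)
  qed
  then show "\<exists>N\<in>preactivations. \<forall>x\<in>K. \<forall>j<w. \<bar>N x j - ?s j x\<bar> < e"
    using N(1) by blast
qed

section \<open>Shears: adding a function of a linear form to one coordinate, with coordinate 0 as
  scratch space\<close>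

definition shear :: "nat \<Rightarrow> (nat \<Rightarrow> real) \<Rightarrow> (real \<Rightarrow> real) \<Rightarrow> (real^'n \<Rightarrow> nat \<Rightarrow> real) \<Rightarrow> real^'n \<Rightarrow> nat \<Rightarrow> real" where
  "shear a \<alpha> \<psi> H = (\<lambda>x. (H x)(a := H x a + \<psi> (\<Sum>i<w. \<alpha> i * H x i), 0 := 0))"

text \<open>The form reads neither the scratch coordinate nor the target, so a shear leaves it
  unchanged; consecutive shears with the same form and target therefore add up.\<close>

lemma sum_shear:
  assumes "\<alpha> 0 = 0" "\<alpha> a = 0"
  shows "(\<Sum>i<w. \<alpha> i * shear a \<beta> \<psi> H x i) = (\<Sum>i<w. \<alpha> i * H x i)"
  using assms by (intro sum.cong) (auto simp: shear_def)

text \<open>Three moves: an affine map writes the argument of \<rho> into coordinate 0, \<rho> is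
  applied there, and an affine map adds \<open>c\<close> times the result to coordinate
  \<open>a\<close> and clears coordinate 0.\<close>

lemma approximable_shear_rho:
  assumes H: "approximable H" and a: "0 < a" "a < w"
  shows "approximable (shear a \<alpha> (\<lambda>s. c * \<rho> (l * s + b)) H)"
proof -
  let ?s = "\<lambda>x. \<Sum>i<w. \<alpha> i * H x i"
  have "approximable (\<lambda>x. (H x)(0 := l * ?s x + b))"
    by (rule approximable_affine[OF H, where A = "\<lambda>j i. if j = 0 then l * \<alpha> i else if i = j then 1 else 0"
          and b = "\<lambda>j. if j = 0 then b else 0"])
      (auto simp: sum_distrib_left mult.assoc if_distrib[of "\<lambda>u. u * _"] cong: if_cong)
  then have "approximable (\<lambda>x. (H x)(0 := \<rho> (l * ?s x + b)))"
    by (rule approximable_cong[OF approximable_rho]) simp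
  then show ?thesis
  proof (rule approximable_affine)
    fix x j assume "x \<in> K" "j < w"
    let ?H = "(H x)(0 := \<rho> (l * ?s x + b))"
    have "(\<Sum>i<w. ((if i = j \<and> j \<noteq> 0 then 1 else 0) + (if i = 0 \<and> j = a then c else 0)) * ?H i)
        = (\<Sum>i<w. (if i = j then if j \<noteq> 0 then ?H j else 0 else 0))
          + (\<Sum>i<w. (if i = 0 then if j = a then c * ?H 0 else 0 else 0))"
      unfolding sum.distrib [symmetric] by (intro sum.cong) (auto simp: distrib_right)
    also have "\<dots> = (if j \<noteq> 0 then ?H j else 0) + (if j = a then c * ?H 0 else 0)"
      using \<open>j < w\<close> w_pos by simp
    finally show "shear a \<alpha> (\<lambda>s. c * \<rho> (l * s + b)) H x j =
        (\<Sum>i<w. ((if i = j \<and> j \<noteq> 0 then 1 else 0) + (if i = 0 \<and> j = a then c else 0)) * ?H i) + 0"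
      using a by (auto simp: shear_def)
  qed
qed

text \<open>The functions for which such shears are possible form a closed function space containing
  all \<open>\<rho> (l * s + b)\<close>, hence every continuous function.\<close>

lemma approximable_shear:
  assumes H: "approximable H" and a: "0 < a" "a < w" and \<alpha>: "\<alpha> 0 = 0" "\<alpha> a = 0"
    and \<psi>: "continuous_on UNIV \<psi>"
  shows "approximable (shear a \<alpha> \<psi> H)"
proof -
  \<comment> \<open>All states \<open>H\<close> are quantified because the shear for a sum applies
    the shear of \<open>g\<close> to the state already sheared by \<open>f\<close>; the factor
    \<open>c\<close> builds in closure under scaling.\<close>
  define V where "V = {\<psi>. \<forall>c H. approximable H \<longrightarrow> approximable (shear a \<alpha> (\<lambda>s. c * \<psi> s) H)}"
  interpret closed_function_space V
  proof
    show "(\<lambda>s. f s + g s) \<in> V" if "f \<in> V" "g \<in> V" for f g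
      unfolding V_def
    proof (intro CollectI allI impI)
      fix c H assume "approximable H"
      then have "approximable (shear a \<alpha> (\<lambda>s. c * g s) (shear a \<alpha> (\<lambda>s. c * f s) H))"
        using that by (auto simp: V_def)
      moreover have "shear a \<alpha> (\<lambda>s. c * g s) (shear a \<alpha> (\<lambda>s. c * f s) H) = shear a \<alpha> (\<lambda>s. c * (f s + g s)) H"
        unfolding shear_def[of a \<alpha> "\<lambda>s. c * g s"] sum_shear[OF \<alpha>]
        using a by (auto simp: shear_def distrib_left fun_eq_iff)
      ultimately show "approximable (shear a \<alpha> (\<lambda>s. c * (f s + g s)) H)" by simp
    qed
    show "(\<lambda>s. c * f s) \<in> V" if "f \<in> V" for f c
      using that by (auto simp: V_def mult.assoc [symmetric])
    have "(\<lambda>_. 0) \<in> V"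
      using approximable_shear_rho[OF _ a, of _ \<alpha> 0] by (simp add: V_def)
    then show "V \<noteq> {}" by blast
    fix f :: "real \<Rightarrow> real"
    assume lim: "\<And>M e. e > 0 \<Longrightarrow> \<exists>g\<in>V. \<forall>s. \<bar>s\<bar> \<le> M \<longrightarrow> \<bar>g s - f s\<bar> < e"
    show "f \<in> V"
      unfolding V_def
    proof (intro CollectI allI impI)
      fix c H assume H: "approximable H"
      obtain B where B: "B \<ge> 0" "\<And>x i. x \<in> K \<Longrightarrow> i < w \<Longrightarrow> \<bar>H x i\<bar> \<le> B"
        using approximable_bound[OF H] by blast
      \<comment> \<open>The linear form stays in a bounded interval on \<open>K\<close>, so
        approximating \<open>f\<close> on that interval is enough.\<close>
      have s: "\<bar>\<Sum>i<w. \<alpha> i * H x i\<bar> \<le> (\<Sum>i<w. \<bar>\<alpha> i\<bar> * B)" if "x \<in> K" for x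
        using B that by (intro order_trans[OF sum_abs] sum_mono) (auto simp: abs_mult intro!: mult_left_mono)
      show "approximable (shear a \<alpha> (\<lambda>s. c * f s) H)"
      proof (rule approximable_limit)
        fix e :: real assume "e > 0"
        then obtain g where g: "g \<in> V" "\<And>s. \<bar>s\<bar> \<le> (\<Sum>i<w. \<bar>\<alpha> i\<bar> * B) \<Longrightarrow> \<bar>g s - f s\<bar> < e / (\<bar>c\<bar> + 1)"
          using lim[of "e / (\<bar>c\<bar> + 1)" "\<Sum>i<w. \<bar>\<alpha> i\<bar> * B"] by fastforce
        have *: "\<bar>c * g s - c * f s\<bar> < e" if "\<bar>s\<bar> \<le> (\<Sum>i<w. \<bar>\<alpha> i\<bar> * B)" for s
        proof -
          have "\<bar>c * g s - c * f s\<bar> = \<bar>c\<bar> * \<bar>g s - f s\<bar>"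
            by (simp add: right_diff_distrib [symmetric] abs_mult)
          also have "\<dots> \<le> \<bar>c\<bar> * (e / (\<bar>c\<bar> + 1))"
            using g(2)[OF that] by (intro mult_left_mono) auto
          also have "\<dots> < e" using \<open>e > 0\<close> by (simp add: field_simps)
          finally show ?thesis .
        qed
        have "\<bar>shear a \<alpha> (\<lambda>s. c * g s) H x i - shear a \<alpha> (\<lambda>s. c * f s) H x i\<bar> < e"
          if "x \<in> K" for x i
          using *[OF s[OF that]] \<open>e > 0\<close> by (simp add: shear_def)
        moreover have "approximable (shear a \<alpha> (\<lambda>s. c * g s) H)"
          using g(1) H by (simp add: V_def)
        ultimately show "\<exists>G. approximable G \<and> (\<forall>x\<in>K. \<forall>i<w. \<bar>G x i - shear a \<alpha> (\<lambda>s. c * f s) H x i\<bar> < e)"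
          by blast
      qed
    qed
  qed
  have "\<psi> \<in> V"
    using cont_rho nonpoly _ \<psi>
  proof (rule nonpolynomial_generates)
    show "(\<lambda>s. \<rho> (l * s + b)) \<in> V" for l b
      using approximable_shear_rho[OF _ a] by (simp add: V_def)
  qed
  then have "approximable (shear a \<alpha> (\<lambda>s. 1 * \<psi> s) H)"
    using H unfolding V_def by blast
  then show ?thesis by simp
qed

text \<open>Coordinates 1 to \<open>CARD('n)\<close> hold the input, the next one accumulates the output
  and coordinate 0 is scratch space: this takes width \<open>CARD('n) + 2\<close>.\<close>
lemma approximable_scalar:
  assumes w: "w \<ge> CARD('n) + 2" and g: "continuous_on K g"
  shows "approximable (\<lambda>x j. if j = 1 then g x else 0)"
proof -
  define n where "n = CARD('n)"
  obtain e :: "'n \<Rightarrow> nat" where e: "bij_betw e UNIV {1..n}"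
    using finite_same_card_bij[of "UNIV :: 'n set" "{1..n}"] unfolding n_def
    by (metis card_atLeastAtMost diff_Suc_1 finite finite_atLeastAtMost)
  \<comment> \<open>The input coordinate numbered \<open>j\<close> by \<open>e\<close>, and 0
    outside \<open>{1..n}\<close>, in particular at the scratch coordinate and the
    accumulator.\<close>
  define P where "P j (x :: real^'n) = (\<Sum>i\<in>UNIV. (if e i = j then 1 else 0) * x $ i)" for j x
  define H where "H f x j = (if j = n + 1 then f x else P j x)" for f :: "real^'n \<Rightarrow> real" and x and j :: nat
  have e_range: "e i \<in> {1..n}" for i using e by (auto simp: bij_betw_def)
  have inj: "e i = e j \<longleftrightarrow> i = j" for i j using e by (auto simp: bij_betw_def inj_on_def)
  have P_e: "P (e i) x = x $ i" for i x
    by (simp add: P_def inj if_distrib[of "\<lambda>u. u * _"] cong: if_cong)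
  have P_0: "P j x = 0" if "j \<notin> {1..n}" for j x
    unfolding P_def using that e_range by (intro sum.neutral) auto
  have sumP: "(\<Sum>j<w. (\<Sum>i\<in>UNIV. if e i = j then a $ i else 0) * H f x j) = a \<bullet> x" for a f x
  proof -
    have "(\<Sum>j<w. (\<Sum>i\<in>UNIV. if e i = j then a $ i else 0) * H f x j)
        = (\<Sum>i\<in>UNIV. \<Sum>j<w. if e i = j then a $ i * H f x j else 0)"
      unfolding sum_distrib_right by (subst sum.swap) (auto intro!: sum.cong)
    also have "\<dots> = (\<Sum>i\<in>UNIV. a $ i * x $ i)"
    proof (intro sum.cong refl)
      fix i
      have "e i < w" "e i \<noteq> n + 1" using e_range[of i] w by (auto simp: n_def)
      then show "(\<Sum>j<w. if e i = j then a $ i * H f x j else 0) = a $ i * x $ i"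
        by (simp add: H_def P_e)
    qed
    finally show ?thesis by (simp add: inner_vec_def)
  qed
  have step: "approximable (H f)" if "f \<in> exp_sums" for f
    using that
  proof induction
    case zero
    show ?case
      by (rule approximable_cong[OF approximable_linear[of "\<lambda>j i. if e i = j then 1 else 0"]])
        (auto simp: H_def P_0 P_def [symmetric])
  next
    case (add_exp f c a)
    define \<alpha> where "\<alpha> j = (\<Sum>i\<in>UNIV. if e i = j then a $ i else 0)" for j
    have \<alpha>: "\<alpha> j = 0" if "j \<notin> {1..n}" for j
      unfolding \<alpha>_def using that e_range by (intro sum.neutral) auto
    \<comment> \<open>The weights \<alpha> are the entries of \<open>a\<close> moved to the
      coordinates that hold the input, so by \<open>sumP\<close> the form is
      \<open>a \<bullet> x\<close>; they vanish at 0 and at \<open>n + 1\<close>.\<close>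
    have "approximable (shear (n + 1) \<alpha> (\<lambda>s. c * exp s) (H f))"
      using add_exp.IH w \<alpha> by (intro approximable_shear) (auto simp: n_def intro!: continuous_intros)
    then show ?case
      by (rule approximable_cong) (auto simp: shear_def \<alpha>_def sumP, auto simp: H_def P_0)
  qed
  have "approximable (H g)"
  proof (rule approximable_limit)
    fix \<epsilon> :: real assume "\<epsilon> > 0"
    then obtain f where "f \<in> exp_sums" "\<And>x. x \<in> K \<Longrightarrow> \<bar>g x - f x\<bar> < \<epsilon>"
      using exp_sums_dense[OF compact_K g] by blast
    then show "\<exists>G. approximable G \<and> (\<forall>x\<in>K. \<forall>i<w. \<bar>G x i - H g x i\<bar> < \<epsilon>)"
      using step \<open>\<epsilon> > 0\<close> by (intro exI[of _ "H f"]) (auto simp: H_def abs_minus_commute)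
  qed
  \<comment> \<open>A linear map moves the accumulator to coordinate 1 and discards the copy of the
    input.\<close>
  then show ?thesis
  proof (rule approximable_affine)
    fix x and j :: nat assume "j < w"
    have "(\<Sum>i<w. (if i = n + 1 \<and> j = 1 then 1 else 0) * H g x i)
        = (\<Sum>i<w. if i = n + 1 then if j = 1 then g x else 0 else 0)"
      by (intro sum.cong) (auto simp: H_def)
    also have "\<dots> = (if j = 1 then g x else 0)"
      using w by (simp add: n_def)
    finally show "(if j = 1 then g x else 0) = (\<Sum>i<w. (if i = n + 1 \<and> j = 1 then 1 else 0) * H g x i) + 0"
      by simp
  qed
qed

text \<open>Once \<open>g x\<close> sits in coordinate 1, the input is no longer stored. Coordinates
  2, 3, and so on are filled one at a time by shears whose form reads coordinate 1 only; the
  induction starts from the scalar case, where \<open>{2..<k}\<close> is empty.\<close>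

lemma approximable_curve:
  assumes w: "w \<ge> CARD('n) + 2" and g: "continuous_on K g"
    and \<gamma>: "\<And>j. continuous_on UNIV (\<gamma> j)"
  shows "approximable (\<lambda>x j. if j = 0 then 0 else if j = 1 then g x else \<gamma> j (g x))"
proof -
  have "approximable (\<lambda>x j. if j = 1 then g x else if j \<in> {2..<k} then \<gamma> j (g x) else 0)"
    if "k \<le> w" for k
    using that
  proof (induction k)
    case 0
    show ?case by (rule approximable_cong[OF approximable_scalar[OF w g]]) simp
  next
    case (Suc k)
    show ?case
    proof (cases "k \<ge> 2")
      case True
      have "approximable (shear k (\<lambda>i. if i = 1 then 1 else 0) (\<gamma> k)
          (\<lambda>x j. if j = 1 then g x else if j \<in> {2..<k} then \<gamma> j (g x) else 0))"
        using Suc True by (intro approximable_shear \<gamma>) auto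
      moreover have "(\<Sum>i<w. (if i = 1 then 1 else 0) * v i) = v 1" for v :: "nat \<Rightarrow> real"
        using w by (simp add: if_distrib[of "\<lambda>u. u * _"] cong: if_cong)
      ultimately show ?thesis
        by (elim approximable_cong) (use True in \<open>auto simp: shear_def\<close>)
    next
      case False
      then show ?thesis
        using Suc.prems by (intro approximable_cong[OF Suc.IH]) auto
    qed
  qed
  from this[of w] show ?thesis
    by (rule approximable_cong) auto
qed

text \<open>The output coordinate \<open>k0\<close> is placed in coordinate 1 and the others in
  \<open>{2..CARD('m)}\<close>. Together with the scratch coordinate 0 this takes width
  \<open>CARD('m) + 1\<close>.\<close>

lemma curve_approximation:
  fixes G :: "real^'n \<Rightarrow> real^'m"
  assumes w: "w \<ge> CARD('n) + 2" "w \<ge> CARD('m) + 1"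
    and g: "continuous_on K (\<lambda>x. G x $ k0)" and \<gamma>: "\<And>k. continuous_on UNIV (\<gamma> k)"
    and G: "\<And>x k. x \<in> K \<Longrightarrow> k \<noteq> k0 \<Longrightarrow> G x $ k = \<gamma> k (G x $ k0)"
    and "\<epsilon> > 0"
  shows "\<exists>f. is_rho_net_of_width \<rho> w f \<and> continuous_on UNIV f \<and> (\<forall>x\<in>K. \<forall>k. \<bar>G x $ k - f x $ k\<bar> < \<epsilon>)"
proof -
  define m where "m = CARD('m)"
  have "m > 0" by (simp add: m_def)
  have "card (UNIV - {k0}) = card {2..m}" by (simp add: m_def card_Diff_singleton)
  then obtain e where e: "bij_betw e (UNIV - {k0}) {2..m}"
    using finite_same_card_bij[of "UNIV - {k0}" "{2..m}"] by auto
  define ind where "ind k = (if k = k0 then 1 else e k)" for k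
  have e_range: "e k \<in> {2..m}" if "k \<noteq> k0" for k using e that by (auto simp: bij_betw_def)
  have inv: "inv_into (UNIV - {k0}) e (e k) = k" if "k \<noteq> k0" for k
    using e that by (simp add: bij_betw_def)
  have ind_w: "ind k < w" for k
    using e_range[of k] w \<open>m > 0\<close> by (auto simp: ind_def m_def)
  let ?H = "\<lambda>x j. if j = 0 then 0 else if j = 1 then G x $ k0
      else \<gamma> (inv_into (UNIV - {k0}) e j) (G x $ k0)"
  have H: "?H x (ind k) = G x $ k" if "x \<in> K" for x k
    using G[OF that, of k] e_range[of k] inv[of k] by (auto simp: ind_def)
  have "approximable ?H"
    by (rule approximable_curve[OF w(1) g \<gamma>])
  then obtain N where N: "N \<in> preactivations" "\<And>x i. x \<in> K \<Longrightarrow> i < w \<Longrightarrow> \<bar>N x i - ?H x i\<bar> < \<epsilon>"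
    using \<open>\<epsilon> > 0\<close> unfolding approximable_def by meson
  have "\<bar>G x $ k - (\<chi> k. N x (ind k)) $ k\<bar> < \<epsilon>" if "x \<in> K" for x k
    using N(2)[OF that ind_w[of k]] unfolding H[OF that] by (simp add: abs_minus_commute)
  moreover have "continuous_on UNIV (\<lambda>x. \<chi> k. N x (ind k))"
    by (intro continuous_on_vec_lambda continuous_on_preactivation N(1))
  ultimately show ?thesis
    using preactivation_is_net[OF N(1), of ind] by blast
qed

end

section \<open>Approximation in the mean\<close>

lemma Lp_pow_lebesgue_on:
  "K \<in> sets lebesgue \<Longrightarrow>
    Lp_pow p K g = (\<integral>\<^sup>+ x. ennreal (\<Sum>i\<in>UNIV. \<bar>g x $ i\<bar> powr p) \<partial>lebesgue_on K)"
  by (simp add: Lp_pow_def nn_integral_restrict_space)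

lemma powr_abs_add_le:
  fixes a b p :: real
  assumes "p \<ge> 0"
  shows "\<bar>a + b\<bar> powr p \<le> 2 powr p * (\<bar>a\<bar> powr p + \<bar>b\<bar> powr p)"
proof -
  have "\<bar>a + b\<bar> powr p \<le> (2 * max \<bar>a\<bar> \<bar>b\<bar>) powr p"
    using assms by (intro powr_mono2) auto
  also have "\<dots> = 2 powr p * (max \<bar>a\<bar> \<bar>b\<bar>) powr p"
    by (simp add: powr_mult)
  also have "\<dots> \<le> 2 powr p * (\<bar>a\<bar> powr p + \<bar>b\<bar> powr p)"
    by (intro mult_left_mono) (auto simp: max_def)
  finally show ?thesis .
qed

text \<open>A substitute for Minkowski's inequality that stays with \<open>p\<close>-th powers, at
  the cost of the factor \<open>2 powr p\<close>.\<close>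

lemma Lp_pow_triangle:
  fixes f g h :: "real^'n \<Rightarrow> real^'m"
  assumes p: "p \<ge> 0" and K: "K \<in> sets lebesgue"
    and [measurable]: "f \<in> borel_measurable (lebesgue_on K)"
      "g \<in> borel_measurable (lebesgue_on K)" "h \<in> borel_measurable (lebesgue_on K)"
  shows "Lp_pow p K (\<lambda>x. f x - h x) \<le>
    ennreal (2 powr p) * (Lp_pow p K (\<lambda>x. f x - g x) + Lp_pow p K (\<lambda>x. g x - h x))"
proof -
  let ?S = "\<lambda>u. \<Sum>i\<in>UNIV. \<bar>u $ i\<bar> powr p"
  let ?M = "lebesgue_on K"
  have "?S (f x - h x) \<le> 2 powr p * (?S (f x - g x) + ?S (g x - h x))" for x
    unfolding sum.distrib [symmetric] sum_distrib_left
  proof (rule sum_mono)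
    fix i
    show "\<bar>(f x - h x) $ i\<bar> powr p \<le> 2 powr p * (\<bar>(f x - g x) $ i\<bar> powr p + \<bar>(g x - h x) $ i\<bar> powr p)"
      using powr_abs_add_le[OF p, of "(f x - g x) $ i" "(g x - h x) $ i"] by simp
  qed
  then have "ennreal (?S (f x - h x)) \<le> ennreal (2 powr p * (?S (f x - g x) + ?S (g x - h x)))" for x
    by (rule ennreal_leI)
  then have le: "ennreal (?S (f x - h x)) \<le>
      ennreal (2 powr p) * (ennreal (?S (f x - g x)) + ennreal (?S (g x - h x)))" for x
    by (simp add: ennreal_mult sum_nonneg)
  have "(\<integral>\<^sup>+ x. ennreal (?S (f x - h x)) \<partial>?M) \<le>
      (\<integral>\<^sup>+ x. ennreal (2 powr p) * (ennreal (?S (f x - g x)) + ennreal (?S (g x - h x))) \<partial>?M)"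
    by (intro nn_integral_mono le)
  also have "\<dots> = ennreal (2 powr p) *
      ((\<integral>\<^sup>+ x. ennreal (?S (f x - g x)) \<partial>?M) + (\<integral>\<^sup>+ x. ennreal (?S (g x - h x)) \<partial>?M))"
    by (subst nn_integral_cmult, measurable, subst nn_integral_add, measurable)
  finally show ?thesis
    by (simp only: Lp_pow_lebesgue_on[OF K])
qed

lemma small_powr:
  fixes C e p :: real
  assumes "p > 0" "C \<ge> 0" "e > 0"
  obtains \<delta> where "0 < \<delta>" "\<delta> \<le> 1" "C * \<delta> powr p \<le> e"
proof (rule that[of "min 1 ((e / (C + 1)) powr (1 / p))"])
  let ?\<delta> = "min 1 ((e / (C + 1)) powr (1 / p))"
  show "0 < ?\<delta>" using assms by simp
  have "?\<delta> powr p \<le> ((e / (C + 1)) powr (1 / p)) powr p"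
    using assms by (intro powr_mono2) auto
  also have "\<dots> = e / (C + 1)" using assms by (simp add: powr_powr)
  finally have "C * ?\<delta> powr p \<le> C * (e / (C + 1))" using assms by (intro mult_left_mono)
  also have "\<dots> \<le> e" using assms by (simp add: field_simps)
  finally show "C * ?\<delta> powr p \<le> e" .
qed simp

text \<open>Serves both for functions close off a small exceptional set \<open>E\<close> and, with
  \<open>E\<close> empty, for uniformly close functions.\<close>

lemma Lp_pow_le_of_bounds:
  fixes g :: "real^'n \<Rightarrow> real^'m"
  assumes p: "p \<ge> 0" and K: "K \<in> sets lebesgue" and E: "E \<in> sets lebesgue" "E \<subseteq> K"
    and small: "\<And>x k. x \<in> K - E \<Longrightarrow> \<bar>g x $ k\<bar> \<le> c"
    and big: "\<And>x k. x \<in> E \<Longrightarrow> \<bar>g x $ k\<bar> \<le> C"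
  shows "Lp_pow p K g \<le> ennreal (CARD('m) * c powr p) * emeasure lebesgue K
     + ennreal (CARD('m) * C powr p) * emeasure lebesgue E"
proof -
  have bnd: "(\<Sum>k\<in>UNIV. \<bar>g x $ k\<bar> powr p) \<le> CARD('m) * a powr p" if "\<And>k. \<bar>g x $ k\<bar> \<le> a" for x a
    using sum_bounded_above[of UNIV "\<lambda>k. \<bar>g x $ k\<bar> powr p" "a powr p"] that p
    by (simp add: powr_mono2)
  have "Lp_pow p K g \<le> (\<integral>\<^sup>+ x. ennreal (CARD('m) * c powr p) * indicator K x
      + ennreal (CARD('m) * C powr p) * indicator E x \<partial>lebesgue)"
    unfolding Lp_pow_def
  proof (rule nn_integral_mono)
    fix x
    show "ennreal (\<Sum>k\<in>UNIV. \<bar>g x $ k\<bar> powr p) * indicator K x \<le> ennreal (CARD('m) * c powr p) * indicator K x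
      + ennreal (CARD('m) * C powr p) * indicator E x"
      using bnd[of x c, OF small] bnd[of x C, OF big] E(2)
      by (cases "x \<in> K"; cases "x \<in> E")
        (auto simp: ennreal_leI add_increasing intro!: ennreal_leI)
  qed
  also have "\<dots> = ennreal (CARD('m) * c powr p) * emeasure lebesgue K
     + ennreal (CARD('m) * C powr p) * emeasure lebesgue E"
    using K E by (subst nn_integral_add) (auto simp: nn_integral_cmult_indicator)
  finally show ?thesis .
qed

text \<open>Simple functions converging pointwise to \<open>f\<close>, with norm at most twice that
  of \<open>f\<close>, converge in the mean by dominated convergence.\<close>

lemma simple_approx_Lp:
  fixes f :: "real^'n \<Rightarrow> real^'m"
  assumes p: "p > 0" and K: "K \<in> sets lebesgue" and f: "in_Lp p K f" and "e > 0"
  obtains s where "simple_function (lebesgue_on K) s" "Lp_pow p K (\<lambda>x. f x - s x) < e"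
proof -
  let ?M = "lebesgue_on K"
  have meas [measurable]: "f \<in> borel_measurable ?M" and fin: "Lp_pow p K f < \<infinity>"
    using f by (auto simp: in_Lp_def)
  obtain F where F: "\<And>i. simple_function ?M (F i)"
    "\<And>x. x \<in> space ?M \<Longrightarrow> (\<lambda>i. F i x) \<longlonglongrightarrow> f x"
    "\<And>i x. x \<in> space ?M \<Longrightarrow> dist (F i x) 0 \<le> 2 * dist (f x) 0"
    using borel_measurable_implies_sequence_metric[OF meas, of 0] by blast
  have measF [measurable]: "F i \<in> borel_measurable ?M" for i
    using F(1) by (rule borel_measurable_simple_function)
  \<comment> \<open>The outer \<open>CARD('m)\<close> counts coordinates, the inner one compares the
    norm with the largest coordinate, and 3 comes from
    \<open>norm (F i x) \<le> 2 * norm (f x)\<close>.\<close>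
  define C where "C = real CARD('m) * (3 * CARD('m)) powr p"
  have C: "C \<ge> 0" by (simp add: C_def)
  have bound: "(\<Sum>k\<in>UNIV. \<bar>(f x - F i x) $ k\<bar> powr p) \<le> C * (\<Sum>k\<in>UNIV. \<bar>f x $ k\<bar> powr p)"
    if "x \<in> space ?M" for x i
  proof -
    define b where "b = Max (range (\<lambda>k. \<bar>f x $ k\<bar>))"
    have b: "\<bar>f x $ k\<bar> \<le> b" for k unfolding b_def by (intro Max_ge) auto
    obtain k0 where k0: "b = \<bar>f x $ k0\<bar>"
    proof -
      have "b \<in> range (\<lambda>k. \<bar>f x $ k\<bar>)" unfolding b_def by (intro Max_in) auto
      then show ?thesis using that by auto
    qed
    have "norm (f x) \<le> (\<Sum>k\<in>UNIV. \<bar>f x $ k\<bar>)" by (rule norm_le_l1_cart)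
    also have "\<dots> \<le> CARD('m) * b"
      using sum_bounded_above[of UNIV "\<lambda>k. \<bar>f x $ k\<bar>" b] b by simp
    finally have nf: "norm (f x) \<le> CARD('m) * b" .
    have "\<bar>(f x - F i x) $ k\<bar> powr p \<le> (3 * CARD('m)) powr p * b powr p" for k
    proof -
      have "\<bar>(f x - F i x) $ k\<bar> \<le> norm (f x - F i x)" by (rule component_le_norm_cart)
      also have "\<dots> \<le> norm (f x) + norm (F i x)" by (rule norm_triangle_ineq4)
      also have "\<dots> \<le> 3 * norm (f x)" using F(3)[OF that, of i] by simp
      finally have "\<bar>(f x - F i x) $ k\<bar> \<le> 3 * CARD('m) * b" using nf by simp
      then have "\<bar>(f x - F i x) $ k\<bar> powr p \<le> (3 * CARD('m) * b) powr p"
        using p by (intro powr_mono2) auto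
      then show ?thesis using k0 by (simp add: powr_mult)
    qed
    then have "(\<Sum>k\<in>UNIV. \<bar>(f x - F i x) $ k\<bar> powr p) \<le> CARD('m) * ((3 * CARD('m)) powr p * b powr p)"
      using sum_bounded_above[of UNIV "\<lambda>k. \<bar>(f x - F i x) $ k\<bar> powr p"] by simp
    also have "\<dots> = C * \<bar>f x $ k0\<bar> powr p" by (simp add: C_def k0)
    also have "\<dots> \<le> C * (\<Sum>k\<in>UNIV. \<bar>f x $ k\<bar> powr p)"
      using C by (intro mult_left_mono member_le_sum) auto
    finally show ?thesis .
  qed
  have "(\<lambda>i. \<integral>\<^sup>+ x. ennreal (\<Sum>k\<in>UNIV. \<bar>(f x - F i x) $ k\<bar> powr p) \<partial>?M) \<longlonglongrightarrow> (\<integral>\<^sup>+ x. 0 \<partial>?M)"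
  proof (rule nn_integral_dominated_convergence[where w = "\<lambda>x. ennreal C * ennreal (\<Sum>k\<in>UNIV. \<bar>f x $ k\<bar> powr p)"])
    have "(\<integral>\<^sup>+ x. ennreal C * ennreal (\<Sum>k\<in>UNIV. \<bar>f x $ k\<bar> powr p) \<partial>?M) = ennreal C * Lp_pow p K f"
      unfolding Lp_pow_lebesgue_on[OF K] by (intro nn_integral_cmult) measurable
    then show "(\<integral>\<^sup>+ x. ennreal C * ennreal (\<Sum>k\<in>UNIV. \<bar>f x $ k\<bar> powr p) \<partial>?M) < \<infinity>"
      using fin by (simp add: ennreal_mult_less_top)
    show "AE x in ?M. ennreal (\<Sum>k\<in>UNIV. \<bar>(f x - F j x) $ k\<bar> powr p)
        \<le> ennreal C * ennreal (\<Sum>k\<in>UNIV. \<bar>f x $ k\<bar> powr p)" for j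
      using bound C by (intro AE_I2) (auto simp: ennreal_mult [symmetric] sum_nonneg intro!: ennreal_leI)
    show "AE x in ?M. (\<lambda>i. ennreal (\<Sum>k\<in>UNIV. \<bar>(f x - F i x) $ k\<bar> powr p)) \<longlonglongrightarrow> 0"
    proof (rule AE_I2)
      fix x assume x: "x \<in> space ?M"
      have "(\<lambda>i. \<bar>(f x - F i x) $ k\<bar> powr p) \<longlonglongrightarrow> 0" for k
      proof (rule tendsto_zero_powrI)
        have "(\<lambda>i. \<bar>(f x - F i x) $ k\<bar>) \<longlonglongrightarrow> \<bar>(f x - f x) $ k\<bar>"
          by (intro tendsto_intros F(2) x)
        then show "(\<lambda>i. \<bar>(f x - F i x) $ k\<bar>) \<longlonglongrightarrow> 0" by simp
      qed (use p in auto)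
      then have "(\<lambda>i. \<Sum>k\<in>UNIV. \<bar>(f x - F i x) $ k\<bar> powr p) \<longlonglongrightarrow> (\<Sum>k\<in>(UNIV::'m set). 0)"
        by (intro tendsto_sum) auto
      then show "(\<lambda>i. ennreal (\<Sum>k\<in>UNIV. \<bar>(f x - F i x) $ k\<bar> powr p)) \<longlonglongrightarrow> 0"
        using tendsto_ennrealI by fastforce
    qed
  qed measurable
  then have "eventually (\<lambda>i. (\<integral>\<^sup>+ x. ennreal (\<Sum>k\<in>UNIV. \<bar>(f x - F i x) $ k\<bar> powr p) \<partial>?M) < e) sequentially"
    using \<open>e > 0\<close> by (intro order_tendstoD) auto
  then obtain i where "(\<integral>\<^sup>+ x. ennreal (\<Sum>k\<in>UNIV. \<bar>(f x - F i x) $ k\<bar> powr p) \<partial>?M) < e"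
    unfolding eventually_sequentially by blast
  then show ?thesis using that[OF F(1)] by (simp add: Lp_pow_lebesgue_on[OF K])
qed

text \<open>Every interval of positive length contains a point that avoids the finitely many values
  already used. This makes one coordinate separate the values of a simple function.\<close>

lemma injective_perturbation:
  fixes \<phi> :: "'a \<Rightarrow> real"
  assumes "finite Y" "\<delta> > 0"
  obtains \<tau> where "inj_on \<tau> Y" "\<And>y. y \<in> Y \<Longrightarrow> \<bar>\<tau> y - \<phi> y\<bar> \<le> \<delta>"
proof -
  have "\<exists>\<tau>. inj_on \<tau> Y \<and> (\<forall>y\<in>Y. \<bar>\<tau> y - \<phi> y\<bar> \<le> \<delta>)"
    using assms(1)
  proof induction
    case (insert y Y)
    then obtain \<tau> where \<tau>: "inj_on \<tau> Y" "\<forall>y\<in>Y. \<bar>\<tau> y - \<phi> y\<bar> \<le> \<delta>" by blast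
    have "infinite ({\<phi> y<..<\<phi> y + \<delta>} - \<tau> ` Y)"
      using insert.hyps assms(2) by (intro Diff_infinite_finite) auto
    then obtain t where "t \<in> {\<phi> y<..<\<phi> y + \<delta>} - \<tau> ` Y"
      using infinite_imp_nonempty by blast
    then have t: "t \<notin> \<tau> ` Y" "\<bar>t - \<phi> y\<bar> \<le> \<delta>" by auto
    have "inj_on (\<tau>(y := t)) (insert y Y)"
      using \<tau>(1) t(1) insert.hyps by (auto simp: inj_on_def)
    moreover have "\<forall>u\<in>insert y Y. \<bar>(\<tau>(y := t)) u - \<phi> u\<bar> \<le> \<delta>"
      using \<tau>(2) t(2) by auto
    ultimately show ?case by blast
  qed auto
  then show ?thesis using that by blast
qed

text \<open>If the coordinate \<open>k0\<close> separates the values of a simple function, then the other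
  coordinates are functions of it, so that the values lie on a graph over the \<open>k0\<close>-axis.\<close>
lemma simple_function_approx_curve:
  fixes s :: "real^'n \<Rightarrow> real^'m" and k0 :: 'm
  assumes p: "p > 0" and K: "compact K" and s: "simple_function (lebesgue_on K) s" and "e > 0"
  obtains G \<gamma> where "continuous_on UNIV (\<lambda>x. G x $ k0)" "\<And>k. continuous_on UNIV (\<gamma> k)"
    "\<And>x k. k \<noteq> k0 \<Longrightarrow> G x $ k = \<gamma> k (G x $ k0)"
    "Lp_pow p K (\<lambda>x. s x - G x) \<le> ennreal e"
proof -
  define Y where "Y = s ` K"
  define \<mu> where "\<mu> = measure lebesgue K"
  have lmK: "K \<in> lmeasurable" using K by (rule lmeasurable_compact)
  then have K_sets: "K \<in> sets lebesgue" and \<mu>: "emeasure lebesgue K = ennreal \<mu>"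
    by (auto simp: \<mu>_def emeasure_eq_measure2)
  have finY: "finite Y"
    using simple_functionD(1)[OF s] by (simp add: Y_def)
  \<comment> \<open>\<open>B - 1\<close> bounds all coordinates of the values; the extra 1 absorbs
    the perturbation, which is at most \<open>\<delta> \<le> 1\<close>.\<close>
  define B where "B = (\<Sum>y\<in>Y. norm y) + 1"
  have "B > 0" unfolding B_def by (intro add_nonneg_pos sum_nonneg) auto
  have B: "\<bar>y $ k\<bar> \<le> B - 1" if "y \<in> Y" for y k
    using component_le_norm_cart[of y k] member_le_sum[OF that, of norm] finY by (simp add: B_def)
  define m where "m = real CARD('m)"
  have "m > 0" by (simp add: m_def)
  have "\<mu> \<ge> 0" by (simp add: \<mu>_def)
  obtain \<delta> where \<delta>: "0 < \<delta>" "\<delta> \<le> 1" "m * \<mu> * \<delta> powr p \<le> e / 2"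
    using small_powr[of p "m * \<mu>" "e / 2"] p \<open>m > 0\<close> \<open>\<mu> \<ge> 0\<close> \<open>e > 0\<close> by auto
  \<comment> \<open>The measure allowed to the exceptional set: there the error is at most
    \<open>2 * B\<close>, so its contribution is at most \<open>e / 2\<close>. The other half is
    spent on the perturbation by \<delta>.\<close>
  define \<delta>' where "\<delta>' = e / (2 * m * ((2 * B) powr p + 1))"
  have \<delta>': "\<delta>' > 0" using \<open>e > 0\<close> \<open>m > 0\<close> by (simp add: \<delta>'_def add_nonneg_pos)
  obtain \<tau> where \<tau>: "inj_on \<tau> Y" "\<And>y. y \<in> Y \<Longrightarrow> \<bar>\<tau> y - y $ k0\<bar> \<le> \<delta>"
    using injective_perturbation[OF finY \<delta>(1), of "\<lambda>y. y $ k0"] by blast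
  have \<tau>B: "\<bar>\<tau> y\<bar> \<le> B" if "y \<in> Y" for y
    using \<tau>(2)[OF that] B[OF that, of k0] \<delta>(2) by auto
  define A where "A y = K \<inter> s -` {y}" for y
  have A_sets: "A y \<in> sets lebesgue" for y
    using simple_functionD(2)[OF s, of "{y}"] K_sets
    by (auto simp: A_def sets_restrict_space_iff Int_commute)
  define \<delta>'' where "\<delta>'' = \<delta>' / (real (card Y) + 1)"
  have \<delta>'': "\<delta>'' > 0" using \<delta>' by (simp add: \<delta>''_def)
  have "\<exists>T. closed T \<and> T \<subseteq> A y \<and> A y - T \<in> lmeasurable \<and> emeasure lebesgue (A y - T) < ennreal \<delta>''" for y
    using sets_lebesgue_inner_closed[OF A_sets \<delta>''] by metis
  then obtain T where T: "\<And>y. closed (T y)" "\<And>y. T y \<subseteq> A y" "\<And>y. A y - T y \<in> lmeasurable"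
    "\<And>y. emeasure lebesgue (A y - T y) < ennreal \<delta>''"
    by metis
  define C where "C = (\<Union>y\<in>Y. T y)"
  have clC: "closed C" unfolding C_def using finY T(1) by (intro closed_UN) auto
  have sT: "s x = y" if "x \<in> T y" for x y using T(2) that by (auto simp: A_def)
  have CK: "C \<subseteq> K" using T(2) by (auto simp: C_def A_def)
  define E where "E = K - C"
  have E_sets: "E \<in> sets lebesgue" using K_sets clC by (auto simp: E_def)
  have "emeasure lebesgue E \<le> emeasure lebesgue (\<Union>y\<in>Y. A y - T y)"
  proof (rule emeasure_mono)
    show "E \<subseteq> (\<Union>y\<in>Y. A y - T y)"
      using sT by (auto simp: E_def C_def A_def Y_def)
    show "(\<Union>y\<in>Y. A y - T y) \<in> sets lebesgue"
      using finY T(3) by (intro sets.finite_UN) auto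
  qed
  also have "\<dots> \<le> (\<Sum>y\<in>Y. emeasure lebesgue (A y - T y))"
    using finY T(3) by (intro emeasure_subadditive_finite) auto
  also have "\<dots> \<le> (\<Sum>y\<in>Y. ennreal \<delta>'')"
    using T(4) by (intro sum_mono) (auto intro: less_imp_le)
  also have "\<dots> = ennreal (real (card Y) * \<delta>'')"
    using \<delta>'' by (simp add: ennreal_mult ennreal_of_nat_eq_real_of_nat)
  also have "\<dots> \<le> ennreal \<delta>'"
    using \<delta>' by (intro ennreal_leI) (simp add: \<delta>''_def field_simps)
  finally have E: "emeasure lebesgue E \<le> ennreal \<delta>'" .
  \<comment> \<open>On each of the finitely many closed pieces \<open>T y\<close> the function
    \<open>s\<close> is constant, so \<open>\<tau> (s x)\<close> is continuous on their union and
    Tietze's theorem extends it.\<close>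
  have "continuous_on C (\<lambda>x. \<tau> (s x))"
    unfolding C_def
  proof (rule continuous_on_closed_Union[OF finY T(1)])
    fix y
    show "continuous_on (T y) (\<lambda>x. \<tau> (s x))"
      using continuous_on_const[of "T y" "\<tau> y"] by (rule continuous_on_eq) (simp add: sT)
  qed
  moreover have "norm (\<tau> (s x)) \<le> B" if "x \<in> C" for x
    using CK that \<tau>B by (auto simp: Y_def)
  ultimately obtain g where g: "continuous_on UNIV g" "\<And>x. x \<in> C \<Longrightarrow> g x = \<tau> (s x)" "\<And>x. norm (g x) \<le> B"
    using Tietze[of C "\<lambda>x. \<tau> (s x)" UNIV B] clC \<open>B > 0\<close> by auto
  \<comment> \<open>Tietze again, now on the finite set of perturbed values: since \<tau> is
    injective on \<open>Y\<close>, the remaining coordinates are functions of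
    \<open>\<tau> y\<close> and are reproduced exactly.\<close>
  have "\<exists>h. continuous_on UNIV h \<and> (\<forall>y\<in>Y. h (\<tau> y) = y $ k) \<and> (\<forall>t. \<bar>h t\<bar> \<le> B)" for k
  proof -
    have "continuous_on (\<tau> ` Y) (\<lambda>t. inv_into Y \<tau> t $ k)" "closed (\<tau> ` Y)"
      using finY by (auto intro: continuous_on_finite finite_imp_closed)
    moreover have "norm (inv_into Y \<tau> t $ k) \<le> B" if "t \<in> \<tau> ` Y" for t
      using B[OF inv_into_into[OF that], of k] by simp
    ultimately obtain h where "continuous_on UNIV h" "\<And>t. t \<in> \<tau> ` Y \<Longrightarrow> h t = inv_into Y \<tau> t $ k"
      "\<And>t. norm (h t) \<le> B"
      using Tietze[of "\<tau> ` Y" "\<lambda>t. inv_into Y \<tau> t $ k" UNIV B] \<open>B > 0\<close> by auto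
    then show ?thesis using \<tau>(1) by (intro exI[of _ h]) auto
  qed
  then obtain \<gamma> where \<gamma>: "\<And>k. continuous_on UNIV (\<gamma> k)" "\<And>k y. y \<in> Y \<Longrightarrow> \<gamma> k (\<tau> y) = y $ k"
    "\<And>k t. \<bar>\<gamma> k t\<bar> \<le> B"
    by metis
  define G where "G x = (\<chi> k. if k = k0 then g x else \<gamma> k (g x))" for x
  have "Lp_pow p K (\<lambda>x. s x - G x) \<le> ennreal (CARD('m) * \<delta> powr p) * emeasure lebesgue K
     + ennreal (CARD('m) * (2 * B) powr p) * emeasure lebesgue E"
  proof (rule Lp_pow_le_of_bounds)
    fix x k
    {
      assume "x \<in> K - E"
      then have "x \<in> C" "s x \<in> Y" by (auto simp: E_def Y_def)
      then show "\<bar>(s x - G x) $ k\<bar> \<le> \<delta>"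
        using \<tau>(2)[of "s x"] \<delta>(1) by (auto simp: G_def g(2) \<gamma>(2) abs_minus_commute)
    next
      assume "x \<in> E"
      then have "s x \<in> Y" by (auto simp: E_def Y_def)
      then have "\<bar>s x $ k\<bar> \<le> B - 1" by (rule B)
      moreover have "\<bar>G x $ k\<bar> \<le> B" using g(3)[of x] \<gamma>(3) by (simp add: G_def)
      ultimately show "\<bar>(s x - G x) $ k\<bar> \<le> 2 * B" by simp
    }
  qed (use p K_sets E_sets in \<open>auto simp: E_def\<close>)
  also have "\<dots> \<le> ennreal (m * \<delta> powr p) * ennreal \<mu> + ennreal (m * (2 * B) powr p) * ennreal \<delta>'"
    unfolding \<mu> m_def by (intro add_left_mono mult_left_mono E) auto
  also have "\<dots> = ennreal (m * \<delta> powr p * \<mu> + m * (2 * B) powr p * \<delta>')"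
    using \<open>m > 0\<close> \<open>\<mu> \<ge> 0\<close> \<delta>' by (simp add: ennreal_mult [symmetric] ennreal_plus [symmetric] del: ennreal_plus)
  also have "\<dots> \<le> ennreal e"
  proof (rule ennreal_leI)
    have "m * (2 * B) powr p * \<delta>' = (e / 2) * ((2 * B) powr p / ((2 * B) powr p + 1))"
      using \<open>m > 0\<close> by (simp add: \<delta>'_def)
    also have "\<dots> \<le> (e / 2) * 1"
      using \<open>e > 0\<close> by (intro mult_left_mono) (auto simp: divide_le_eq_1 add_nonneg_pos)
    finally show "m * \<delta> powr p * \<mu> + m * (2 * B) powr p * \<delta>' \<le> e" using \<delta>(3) by (simp add: mult_ac)
  qed
  finally have "Lp_pow p K (\<lambda>x. s x - G x) \<le> ennreal e" .
  moreover have "continuous_on UNIV (\<lambda>x. G x $ k0)" using g(1) by (simp add: G_def)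
  moreover have "G x $ k = \<gamma> k (G x $ k0)" if "k \<noteq> k0" for x k
    using that by (simp add: G_def)
  ultimately show ?thesis using that[of G \<gamma>] \<gamma>(1) by blast
qed

theorem theorem4:
  fixes \<rho> :: "real \<Rightarrow> real" and K :: "(real^'n) set" and w :: nat and p :: real
  assumes "compact K"
    and "continuous_on UNIV \<rho>"
    and "\<not> (\<exists>q. \<forall>x. \<rho> x = poly q x)"
    and "\<exists>z. (\<exists>e>0. \<forall>y\<in>ball z e. \<rho> differentiable (at y))
              \<and> isCont (deriv \<rho>) z \<and> deriv \<rho> z \<noteq> 0"
    and "w \<ge> CARD('n) + 2" and "w \<ge> CARD('m) + 1"
    and "1 \<le> p"
  shows "\<forall>(fstar :: real^'n \<Rightarrow> real^'m) \<epsilon>. in_Lp p K fstar \<and> \<epsilon> > 0 \<longrightarrow>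
           (\<exists>f. is_rho_net_of_width \<rho> w f \<and>
                Lp_pow p K (\<lambda>x. fstar x - f x) \<le> ennreal (\<epsilon> powr p))"
proof (intro allI impI)
  fix fstar :: "real^'n \<Rightarrow> real^'m" and \<epsilon> :: real
  assume "in_Lp p K fstar \<and> \<epsilon> > 0"
  then have f: "in_Lp p K fstar" and "\<epsilon> > 0" by auto
  obtain z e where z: "e > 0" "\<forall>y\<in>ball z e. \<rho> differentiable (at y)" "deriv \<rho> z \<noteq> 0"
    using assms(4) by blast
  then have "\<rho> differentiable (at z)" by auto
  then have "(\<rho> has_real_derivative deriv \<rho> z) (at z)"
    by (simp add: DERIV_deriv_iff_real_differentiable)
  then interpret rho_networks \<rho> z "deriv \<rho> z" w K
    using assms z by unfold_locales auto
  have p: "p > 0" "p \<ge> 0" using assms(7) by auto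
  have K: "K \<in> lmeasurable" using assms(1) by (rule lmeasurable_compact)
  then have K_sets: "K \<in> sets lebesgue" and K_measure: "emeasure lebesgue K = ennreal (measure lebesgue K)"
    by (auto simp: emeasure_eq_measure2)
  define c where "c = 2 powr p"
  define E where "E = \<epsilon> powr p"
  have c: "c > 0" and E: "E > 0" using \<open>\<epsilon> > 0\<close> by (auto simp: c_def E_def)
  \<comment> \<open>Each of the two triangle inequalities costs a factor \<open>c\<close>. The first
    turns two errors \<open>E / (4 * c * c)\<close> into \<open>E / (2 * c)\<close>; the second
    turns this and an equal network error into \<open>E\<close>.\<close>
  obtain s where s: "simple_function (lebesgue_on K) s"
    "Lp_pow p K (\<lambda>x. fstar x - s x) < ennreal (E / (4 * c * c))"
    using simple_approx_Lp[OF p(1) K_sets f, of "ennreal (E / (4 * c * c))"] c E by auto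
  \<comment> \<open>Any output coordinate can serve as the parameter of the curve.\<close>
  obtain k0 :: 'm where True by blast
  obtain G \<gamma> where G: "continuous_on UNIV (\<lambda>x. G x $ k0)" "\<And>k. continuous_on UNIV (\<gamma> k)"
    "\<And>x k. k \<noteq> k0 \<Longrightarrow> G x $ k = \<gamma> k (G x $ k0)"
    "Lp_pow p K (\<lambda>x. s x - G x) \<le> ennreal (E / (4 * c * c))"
    using simple_function_approx_curve[OF p(1) assms(1) s(1), of "E / (4 * c * c)" k0] c E by auto
  have contG: "continuous_on UNIV G"
  proof -
    have "continuous_on UNIV (\<lambda>x. G x $ k)" for k
    proof (cases "k = k0")
      case False
      then show ?thesis
        using continuous_on_compose2[OF G(2)[of k] G(1)] by (simp add: G(3))
    qed (use G(1) in simp)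
    then show ?thesis
      using continuous_on_vec_lambda[of UNIV "\<lambda>k x. G x $ k"] by simp
  qed
  obtain \<eta> where \<eta>: "0 < \<eta>" "CARD('m) * measure lebesgue K * \<eta> powr p \<le> E / (2 * c)"
    using small_powr[OF p(1), of "CARD('m) * measure lebesgue K" "E / (2 * c)"] c E by auto
  have "\<exists>f. is_rho_net_of_width \<rho> w f \<and> continuous_on UNIV f \<and> (\<forall>x\<in>K. \<forall>k. \<bar>G x $ k - f x $ k\<bar> < \<eta>)"
    by (rule curve_approximation[OF assms(5,6) continuous_on_subset[OF G(1)] G(2) G(3) \<eta>(1)]) auto
  then obtain f where net: "is_rho_net_of_width \<rho> w f" and contf: "continuous_on UNIV f"
    and close: "\<And>x k. x \<in> K \<Longrightarrow> \<bar>G x $ k - f x $ k\<bar> < \<eta>"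
    by blast
  have meas [simp]: "fstar \<in> borel_measurable (lebesgue_on K)" "s \<in> borel_measurable (lebesgue_on K)"
    "G \<in> borel_measurable (lebesgue_on K)" "f \<in> borel_measurable (lebesgue_on K)"
    using f borel_measurable_simple_function[OF s(1)] K_sets
      continuous_imp_measurable_on_sets_lebesgue[OF continuous_on_subset[OF contG]]
      continuous_imp_measurable_on_sets_lebesgue[OF continuous_on_subset[OF contf]]
    by (auto simp: in_Lp_def)
  have "Lp_pow p K (\<lambda>x. fstar x - G x) \<le>
      ennreal c * (Lp_pow p K (\<lambda>x. fstar x - s x) + Lp_pow p K (\<lambda>x. s x - G x))"
    unfolding c_def by (rule Lp_pow_triangle[OF p(2) K_sets]) simp_all
  also have "\<dots> \<le> ennreal c * (ennreal (E / (4 * c * c)) + ennreal (E / (4 * c * c)))"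
    using s(2) G(4) by (intro mult_left_mono add_mono) auto
  also have "\<dots> = ennreal (c * (E / (4 * c * c) + E / (4 * c * c)))"
    using c E by (subst ennreal_mult; (subst ennreal_plus)?) simp_all
  also have "c * (E / (4 * c * c) + E / (4 * c * c)) = E / (2 * c)"
    using c by (simp add: field_simps)
  finally have fG: "Lp_pow p K (\<lambda>x. fstar x - G x) \<le> ennreal (E / (2 * c))" .
  have "Lp_pow p K (\<lambda>x. G x - f x) \<le> ennreal (CARD('m) * \<eta> powr p) * emeasure lebesgue K
     + ennreal (CARD('m) * 0 powr p) * emeasure lebesgue ({} :: (real^'n) set)"
    using close by (intro Lp_pow_le_of_bounds p(2) K_sets) (auto intro: less_imp_le)
  also have "\<dots> = ennreal (CARD('m) * measure lebesgue K * \<eta> powr p)"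
    by (simp add: K_measure ennreal_mult [symmetric] mult_ac)
  also have "\<dots> \<le> ennreal (E / (2 * c))" by (rule ennreal_leI[OF \<eta>(2)])
  finally have Gf: "Lp_pow p K (\<lambda>x. G x - f x) \<le> ennreal (E / (2 * c))" .
  have "Lp_pow p K (\<lambda>x. fstar x - f x) \<le>
      ennreal c * (Lp_pow p K (\<lambda>x. fstar x - G x) + Lp_pow p K (\<lambda>x. G x - f x))"
    unfolding c_def by (rule Lp_pow_triangle[OF p(2) K_sets]) simp_all
  also have "\<dots> \<le> ennreal c * (ennreal (E / (2 * c)) + ennreal (E / (2 * c)))"
    using fG Gf by (intro mult_left_mono add_mono) auto
  also have "\<dots> = ennreal (c * (E / (2 * c) + E / (2 * c)))"
    using c E by (subst ennreal_mult; (subst ennreal_plus)?) simp_all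
  also have "c * (E / (2 * c) + E / (2 * c)) = E" using c by (simp add: field_simps)
  finally show "\<exists>f. is_rho_net_of_width \<rho> w f \<and> Lp_pow p K (\<lambda>x. fstar x - f x) \<le> ennreal (\<epsilon> powr p)"
    using net unfolding E_def by blast
qed

end
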